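(* Let $\mathfrak A$ be a tree-automatic linear ordering. Then $\mathrm{FC}(\mathfrak A)<\omega^\omega$.
   Context: A linear ordering $\mathfrak A=(A;\le)$ is tree-automatic if it admits a tree-automatic presentation: deterministic bottom-up tree automata $\mathcal A,\mathcal A_\le$ over finite binary $\Sigma$-labelled trees (maps $t:D\to\Sigma$, $D\subseteq\{0,1\}^*$ finite and prefix-closed) and a bijection $\mu:A\to L(\mathcal A)$ such that $\mathcal A_\le$ recognises the set of convolutions $\otimes(\mu(a),\mu(b))$ with $a\le b$ (convolution: overlay the trees on the union of their domains, labelling with tuples and padding undefined positions with a fresh symbol $\Box$). $\mathrm{FC}$-rank: A condensation on a linear ordering $\mathfrak A$ is an equivalence relation whose classes are intervals; the classes are then linearly ordered, giving $\mathfrak A/{\sim}$. Define $\sim_0$ to be equality; $x\sim_{\beta+1}y$ iff the closed interval between the $\sim_\beta$-classes of $x$ and $y$ in $\mathfrak A/{\sim_\beta}$ is finite; for limit $\alpha$, $x\sim_\alpha y$ iff $x\sim_\beta y$ for some $\beta<\alpha$. $\mathrm{FC}(\mathfrak A)$ is the least ordinal $\alpha$ such that $\sim_\alpha$ and $\sim_\beta$ coincide for all $\beta\ge\alpha$. *)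

theory Defs
  imports Main "HOL-Library.Multiset_Order"
begin

text \<open>A finite binary tree is a partial map from positions in {0,1}* (lists of booleans,
  False = 0, True = 1) to labels, whose domain is finite and prefix-closed.\<close>

type_synonym 's tree = "bool list \<Rightarrow> 's option"

definition is_tree :: "'s set \<Rightarrow> 's tree \<Rightarrow> bool" where
  "is_tree \<Sigma> t \<longleftrightarrow> finite (dom t) \<and> (\<forall>u v. u @ v \<in> dom t \<longrightarrow> u \<in> dom t) \<and> ran t \<subseteq> \<Sigma>"

text \<open>Convolution of two trees: overlay on the union of domains, padding with the
  fresh symbol box, represented by None.\<close>

definition conv :: "'s tree \<Rightarrow> 's tree \<Rightarrow> ('s option \<times> 's option) tree" where
  "conv t s = (\<lambda>u. if t u = None \<and> s u = None then None else Some (t u, s u))"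

record 's dta =
  alphabet :: "'s set"
  states :: "nat set"
  init :: nat
  trans :: "nat \<Rightarrow> 's \<Rightarrow> nat \<Rightarrow> nat"
  final :: "nat set"

definition wf_dta :: "'s dta \<Rightarrow> bool" where
  "wf_dta M \<longleftrightarrow> finite (alphabet M) \<and> finite (states M) \<and> init M \<in> states M
     \<and> (\<forall>p q a. p \<in> states M \<and> q \<in> states M \<and> a \<in> alphabet M \<longrightarrow> trans M p a q \<in> states M)
     \<and> final M \<subseteq> states M"

definition is_run :: "'s dta \<Rightarrow> 's tree \<Rightarrow> (bool list \<Rightarrow> nat) \<Rightarrow> bool" where
  "is_run M t \<rho> \<longleftrightarrow> (\<forall>u. \<rho> u = (case t u of None \<Rightarrow> init M
       | Some a \<Rightarrow> trans M (\<rho> (u @ [False])) a (\<rho> (u @ [True]))))"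

definition lang :: "'s dta \<Rightarrow> 's tree set" where
  "lang M = {t. is_tree (alphabet M) t \<and> (\<exists>\<rho>. is_run M t \<rho> \<and> \<rho> [] \<in> final M)}"

definition tree_automatic :: "'a set \<Rightarrow> 'a rel \<Rightarrow> bool" where
  "tree_automatic A r \<longleftrightarrow>
     (\<exists>(M :: nat dta) (Mle :: (nat option \<times> nat option) dta) (\<mu> :: 'a \<Rightarrow> nat tree).
        wf_dta M \<and> wf_dta Mle \<and> bij_betw \<mu> A (lang M) \<and>
        lang Mle = {conv (\<mu> a) (\<mu> b) | a b. a \<in> A \<and> b \<in> A \<and> (a, b) \<in> r})"

definition fc_step :: "'a set \<Rightarrow> 'a rel \<Rightarrow> 'a rel \<Rightarrow> 'a rel" where
  "fc_step A r R = {(x, y). x \<in> A \<and> y \<in> A \<and>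
     finite {R `` {z} | z. z \<in> A \<and> (((x, z) \<in> r \<and> (z, y) \<in> r) \<or> ((y, z) \<in> r \<and> (z, x) \<in> r))}}"

text \<open>The condensations sim_alpha, indexed by the elements of an arbitrary well-ordered
  type standing for an initial segment of the ordinals: equality at the least element,
  fc_step at successors, union of all earlier stages at limits.\<close>

definition is_succ_of :: "'o::wellorder \<Rightarrow> 'o \<Rightarrow> bool" where
  "is_succ_of \<alpha> \<beta> \<longleftrightarrow> \<beta> < \<alpha> \<and> (\<forall>\<gamma>. \<not> (\<beta> < \<gamma> \<and> \<gamma> < \<alpha>))"

definition fc_cond :: "'a set \<Rightarrow> 'a rel \<Rightarrow> 'o::wellorder \<Rightarrow> 'a rel" where
  "fc_cond A r = wfrec {(\<beta>, \<alpha>). \<beta> < \<alpha>}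
     (\<lambda>f \<alpha>. if \<forall>\<beta>. \<not> \<beta> < \<alpha> then Id_on A
            else if \<exists>\<beta>. is_succ_of \<alpha> \<beta> then fc_step A r (f (THE \<beta>. is_succ_of \<alpha> \<beta>))
            else (\<Union>\<beta>\<in>{\<beta>. \<beta> < \<alpha>}. f \<beta>))"

definition fc_stable_from :: "'a set \<Rightarrow> 'a rel \<Rightarrow> 'o::wellorder \<Rightarrow> bool" where
  "fc_stable_from A r \<alpha> \<longleftrightarrow> (\<forall>\<beta>. \<alpha> \<le> \<beta> \<longrightarrow> fc_cond A r \<beta> = fc_cond A r \<alpha>)"

text \<open>The type nat multiset with the (Dershowitz-Manna) multiset order is a well-order
  of order type omega^omega.  Hence FC(A) < omega^omega iff the hierarchy, indexed by
  this type, stabilises from some index.\<close>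

definition FC_less_omega_omega :: "'a set \<Rightarrow> 'a rel \<Rightarrow> bool" where
  "FC_less_omega_omega A r \<longleftrightarrow> (\<exists>\<alpha> :: nat multiset. fc_stable_from A r \<alpha>)"

end

theory Submission
  imports Defs "HOL-Library.FuncSet"
begin

text \<open>
  Let \<open>[a, b]\<close> be an interval of the order on trees and \<open>D\<close> the union of the domains of \<open>a\<close>
  and \<open>b\<close>. Among the trees of \<open>[a, b]\<close> with a fixed restriction to \<open>D\<close> and fixed types of the
  subtrees hanging below \<open>D\<close>, these subtrees can be exchanged independently, and the order
  depends only on the states that the automaton reaches on the pairs of corresponding subtrees.
  So \<open>[a, b]\<close> is a finite union of products of linear orders, ordered by a linear extension of
  the product order that is determined by finite colourings of the pairs in each factor. The
  factors come from a finite list that depends on the automata only.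

  The rank of such a product is at most the Hessenberg sum of the ranks of its factors. The
  critical case is a product \<open>B \<times> C\<close> in which proper initial segments of \<open>B\<close> and proper final
  segments of \<open>C\<close> have smaller rank. The colours that recur cofinally in \<open>B\<close> and coinitially
  in \<open>C\<close> show that one coordinate dominates the other, whence intervals of the product have
  smaller rank. Without the colourings this fails.

  Since the list of factors is finite, some \<open>k\<close> has no factor with rank in
  \<open>[\<omega>\<^sup>k, \<omega>\<^bsup>k+1\<^esup>)\<close>. As \<open>\<omega>\<^sup>k\<close> is closed under Hessenberg sums, no interval has rank in this
  range either, and the condensations are stable from \<open>\<omega>\<^sup>k\<close> on.
\<close>

section \<open>Ranks of linear orders\<close>

definition lin_on :: "'a set \<Rightarrow> ('a \<Rightarrow> 'a \<Rightarrow> bool) \<Rightarrow> bool" where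
  "lin_on X le \<longleftrightarrow> (\<forall>x\<in>X. le x x) \<and> (\<forall>x\<in>X. \<forall>y\<in>X. le x y \<longrightarrow> le y x \<longrightarrow> x = y) \<and>
     (\<forall>x\<in>X. \<forall>y\<in>X. \<forall>z\<in>X. le x y \<longrightarrow> le y z \<longrightarrow> le x z) \<and> (\<forall>x\<in>X. \<forall>y\<in>X. le x y \<or> le y x)"

lemma lin_onD:
  assumes "lin_on X le"
  shows lin_on_refl: "x \<in> X \<Longrightarrow> le x x"
    and lin_on_antisym: "\<lbrakk>le x y; le y x; x \<in> X; y \<in> X\<rbrakk> \<Longrightarrow> x = y"
    and lin_on_trans: "\<lbrakk>le x y; le y z; x \<in> X; y \<in> X; z \<in> X\<rbrakk> \<Longrightarrow> le x z"
    and lin_on_linear: "\<lbrakk>x \<in> X; y \<in> X\<rbrakk> \<Longrightarrow> le x y \<or> le y x"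
  using assms unfolding lin_on_def by blast+

lemma lin_on_converse: "lin_on X le \<Longrightarrow> lin_on X (\<lambda>x y. le y x)"
  unfolding lin_on_def by (elim conjE, intro conjI; blast)

lemma lin_on_pullback:
  assumes "lin_on X le" "f ` Y \<subseteq> X" "inj_on f Y"
    and eq: "\<And>x y. x \<in> Y \<Longrightarrow> y \<in> Y \<Longrightarrow> le' x y \<longleftrightarrow> le (f x) (f y)"
  shows "lin_on Y le'"
proof -
  have f: "f x \<in> X" if "x \<in> Y" for x using assms(2) that by blast
  note lin = lin_onD[OF assms(1)]
  show ?thesis
    unfolding lin_on_def
  proof (intro conjI ballI impI)
    fix x assume "x \<in> Y" then show "le' x x" using eq f lin(1) by simp
  next
    fix x y assume "x \<in> Y" "y \<in> Y" "le' x y" "le' y x"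
    then show "x = y" using eq f lin(2) assms(3) by (meson inj_onD)
  next
    fix x y z assume "x \<in> Y" "y \<in> Y" "z \<in> Y" "le' x y" "le' y z"
    then show "le' x z" using eq f lin(3) by meson
  next
    fix x y assume "x \<in> Y" "y \<in> Y"
    then show "le' x y \<or> le' y x" using eq f lin(4) by simp
  qed
qed

lemma lin_on_subset: "lin_on X le \<Longrightarrow> Y \<subseteq> X \<Longrightarrow> lin_on Y le"
  by (erule lin_on_pullback[where f = id]) auto

text \<open>For a linear order, \<open>rank_le le \<alpha> A\<close> says that \<open>A\<close> has only finitely many classes
  with respect to the \<open>\<alpha>\<close>-th condensation. Allowing arbitrary pieces, not only intervals,
  makes closure under finite unions immediate.\<close>

inductive rank_le :: "('a \<Rightarrow> 'a \<Rightarrow> bool) \<Rightarrow> 'o::wellorder \<Rightarrow> 'a set \<Rightarrow> bool" for le where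
  rank_leI: "\<lbrakk>finite F; A = \<Union>F;
     \<forall>B\<in>F. \<forall>x\<in>B. \<forall>y\<in>B. x \<noteq> y \<longrightarrow> le x y \<longrightarrow> (\<exists>\<beta><\<alpha>. rank_le le \<beta> {z\<in>B. le x z \<and> le z y})\<rbrakk>
    \<Longrightarrow> rank_le le \<alpha> A"

definition rank_less :: "('a \<Rightarrow> 'a \<Rightarrow> bool) \<Rightarrow> 'o::wellorder \<Rightarrow> 'a set \<Rightarrow> bool" where
  "rank_less le \<alpha> A \<longleftrightarrow> (\<exists>\<beta><\<alpha>. rank_le le \<beta> A)"

text \<open>The condition on one piece of a cover; intervals are taken inside the piece itself. Only
  distinct end points are tested, so at the least index the pieces of a linear order have at most
  one element.\<close>

definition locally_less :: "('a \<Rightarrow> 'a \<Rightarrow> bool) \<Rightarrow> 'o::wellorder \<Rightarrow> 'a set \<Rightarrow> bool" where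
  "locally_less le \<alpha> B \<longleftrightarrow>
     (\<forall>x\<in>B. \<forall>y\<in>B. x \<noteq> y \<longrightarrow> le x y \<longrightarrow> rank_less le \<alpha> {z\<in>B. le x z \<and> le z y})"

lemma rank_le_iff:
  "rank_le le \<alpha> A \<longleftrightarrow> (\<exists>F. finite F \<and> A = \<Union>F \<and> (\<forall>B\<in>F. locally_less le \<alpha> B))"
  by (subst rank_le.simps) (auto simp: locally_less_def rank_less_def)

section \<open>Monotonicity, embeddings, converses and finite unions\<close>

lemma rank_less_mono: "rank_less le \<alpha> A \<Longrightarrow> \<alpha> \<le> \<beta> \<Longrightarrow> rank_less le \<beta> A"
  unfolding rank_less_def by (blast intro: order.strict_trans2)

lemma rank_le_mono:
  assumes "rank_le le \<alpha> A" "\<alpha> \<le> \<beta>" shows "rank_le le \<beta> A"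
proof -
  have "locally_less le \<beta> B" if "locally_less le \<alpha> B" for B
    unfolding locally_less_def
    using that[unfolded locally_less_def] by (intro ballI impI rank_less_mono[OF _ assms(2)]) simp
  with assms(1) show ?thesis unfolding rank_le_iff by blast
qed

lemma rank_less_imp_le: "rank_less le \<alpha> A \<Longrightarrow> rank_le le \<alpha> A"
  unfolding rank_less_def by (auto intro: rank_le_mono)

text \<open>Pull the pieces back along \<open>f\<close>: an interval with end points
  \<open>x\<close> and \<open>y\<close> is mapped into the interval from \<open>f x\<close> to
  \<open>f y\<close>. The image may have gaps, so this serves restrictions, swaps of coordinates and
  the passage between trees and the given order alike.\<close>

lemma rank_le_embed:
  assumes "rank_le le \<alpha> A" "f ` A' \<subseteq> A" "inj_on f A'"
    and "\<And>x y. x \<in> A' \<Longrightarrow> y \<in> A' \<Longrightarrow> le' x y \<Longrightarrow> le (f x) (f y)"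
  shows "rank_le le' \<alpha> A'"
  using assms
proof (induction \<alpha> A arbitrary: A' rule: rank_le.induct)
  case (rank_leI F A \<alpha>)
  let ?p = "\<lambda>B. {x\<in>A'. f x \<in> B}"
  show ?case
  proof (rule rank_le.rank_leI[of "?p ` F"])
    show "finite (?p ` F)" using rank_leI by simp
    show "A' = \<Union>(?p ` F)" using rank_leI.prems(1) rank_leI.hyps(2) by blast
    show "\<forall>B\<in>?p ` F. \<forall>x\<in>B. \<forall>y\<in>B. x \<noteq> y \<longrightarrow> le' x y \<longrightarrow>
        (\<exists>\<beta><\<alpha>. rank_le le' \<beta> {z \<in> B. le' x z \<and> le' z y})"
    proof (intro ballI impI)
      fix B' x y assume "B' \<in> ?p ` F" and xy: "x \<in> B'" "y \<in> B'" "x \<noteq> y" "le' x y"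
      then obtain B where B: "B \<in> F" "B' = ?p B" by blast
      have fxy: "f x \<in> B" "f y \<in> B" using xy B by auto
      have "f x \<noteq> f y" using xy B rank_leI.prems(2) by (auto dest: inj_onD)
      moreover have "le (f x) (f y)" using rank_leI.prems(3) xy B by blast
      ultimately have "\<exists>\<beta><\<alpha>. rank_le le \<beta> {z\<in>B. le (f x) z \<and> le z (f y)} \<and>
          (\<forall>A'. f ` A' \<subseteq> {z\<in>B. le (f x) z \<and> le z (f y)} \<longrightarrow> inj_on f A' \<longrightarrow>
          (\<forall>x. x \<in> A' \<longrightarrow> (\<forall>y. y \<in> A' \<longrightarrow> le' x y \<longrightarrow> le (f x) (f y))) \<longrightarrow> rank_le le' \<beta> A')"
        by (rule rank_leI.IH[rule_format, OF B(1) fxy])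
      then obtain \<beta> where \<beta>: "\<beta> < \<alpha>" and
        IH: "\<forall>A'. f ` A' \<subseteq> {z\<in>B. le (f x) z \<and> le z (f y)} \<longrightarrow> inj_on f A' \<longrightarrow>
          (\<forall>x. x \<in> A' \<longrightarrow> (\<forall>y. y \<in> A' \<longrightarrow> le' x y \<longrightarrow> le (f x) (f y))) \<longrightarrow> rank_le le' \<beta> A'"
        by (elim exE conjE) 
      have "rank_le le' \<beta> {z \<in> B'. le' x z \<and> le' z y}"
        using B xy rank_leI.prems by (intro IH[rule_format]) (auto intro: inj_on_subset)
      with \<beta> show "\<exists>\<beta><\<alpha>. rank_le le' \<beta> {z \<in> B'. le' x z \<and> le' z y}" by blast
    qed
  qed
qed

lemma rank_less_embed:
  assumes "rank_less le \<alpha> A" "f ` A' \<subseteq> A" "inj_on f A'"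
    and "\<And>x y. x \<in> A' \<Longrightarrow> y \<in> A' \<Longrightarrow> le' x y \<Longrightarrow> le (f x) (f y)"
  shows "rank_less le' \<alpha> A'"
  using assms rank_le_embed[of le _ A f A' le'] unfolding rank_less_def by blast

lemma rank_le_subset: "rank_le le \<alpha> A \<Longrightarrow> B \<subseteq> A \<Longrightarrow> rank_le le \<alpha> B"
  by (erule rank_le_embed[where f = id]) auto

lemma rank_less_subset: "rank_less le \<alpha> A \<Longrightarrow> B \<subseteq> A \<Longrightarrow> rank_less le \<alpha> B"
  unfolding rank_less_def by (meson rank_le_subset)

lemma rank_le_converse: "rank_le le \<alpha> A \<Longrightarrow> rank_le (\<lambda>x y. le y x) \<alpha> A"
proof (induction \<alpha> A rule: rank_le.induct)
  case (rank_leI F A \<alpha>)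
  show ?case
  proof (rule rank_le.rank_leI[OF rank_leI.hyps(1,2)], intro ballI impI)
    fix B x y assume *: "B \<in> F" "x \<in> B" "y \<in> B" "x \<noteq> y" "le y x"
    have "\<exists>\<beta><\<alpha>. rank_le le \<beta> {z \<in> B. le y z \<and> le z x} \<and>
        rank_le (\<lambda>x y. le y x) \<beta> {z \<in> B. le y z \<and> le z x}"
      by (rule rank_leI.IH[rule_format, OF *(1,3,2) *(4)[symmetric] *(5)])
    moreover have "{z \<in> B. le y z \<and> le z x} = {z \<in> B. le z x \<and> le y z}" by blast
    ultimately show "\<exists>\<beta><\<alpha>. rank_le (\<lambda>x y. le y x) \<beta> {z \<in> B. le z x \<and> le y z}"
      by (metis (no_types))
  qed
qed

lemma rank_less_converse: "rank_less le \<alpha> A \<Longrightarrow> rank_less (\<lambda>x y. le y x) \<alpha> A"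
  unfolding rank_less_def by (elim exE conjE, intro exI conjI, assumption, rule rank_le_converse)

lemma locally_less_imp_rank_le: "locally_less le \<alpha> B \<Longrightarrow> rank_le le \<alpha> B"
  unfolding rank_le_iff by (intro exI[of _ "{B}"]) auto

lemma locally_less_subset:
  assumes "locally_less le \<alpha> B" "C \<subseteq> B" shows "locally_less le \<alpha> C"
  unfolding locally_less_def
proof (intro ballI impI)
  fix x y assume "x \<in> C" "y \<in> C" "x \<noteq> y" "le x y"
  then have "rank_less le \<alpha> {z \<in> B. le x z \<and> le z y}"
    using assms unfolding locally_less_def by blast
  then show "rank_less le \<alpha> {z \<in> C. le x z \<and> le z y}"
    by (rule rank_less_subset) (use assms in auto)
qed

lemma locally_less_converse:
  assumes "locally_less le \<alpha> B" shows "locally_less (\<lambda>x y. le y x) \<alpha> B"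
  unfolding locally_less_def
proof (intro ballI impI)
  fix x y assume *: "x \<in> B" "y \<in> B" "x \<noteq> y" "le y x"
  have "rank_less le \<alpha> {z \<in> B. le y z \<and> le z x}"
    by (rule assms[unfolded locally_less_def, rule_format, OF *(2,1) *(3)[symmetric] *(4)])
  from rank_less_converse[OF this]
  show "rank_less (\<lambda>x y. le y x) \<alpha> {z \<in> B. le z x \<and> le y z}"
    by (rule rank_less_subset) auto
qed

lemma rank_le_Union:
  assumes "finite G" "\<And>A. A \<in> G \<Longrightarrow> rank_le le \<alpha> A"
  shows "rank_le le \<alpha> (\<Union>G)"
proof -
  obtain F where F: "\<And>A. A \<in> G \<Longrightarrow> finite (F A) \<and> A = \<Union>(F A) \<and> (\<forall>B\<in>F A. locally_less le \<alpha> B)"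
    using assms(2) unfolding rank_le_iff by metis
  have "\<Union>(F A) = A" if "A \<in> G" for A using F[OF that] by simp
  then have "\<Union>(\<Union>A\<in>G. F A) = \<Union>G" by fastforce
  moreover have "finite (\<Union>A\<in>G. F A)" "\<forall>B\<in>\<Union>A\<in>G. F A. locally_less le \<alpha> B"
    using F assms(1) by simp_all
  ultimately show ?thesis unfolding rank_le_iff by metis
qed

lemma rank_le_Un: "rank_le le \<alpha> A \<Longrightarrow> rank_le le \<alpha> B \<Longrightarrow> rank_le le \<alpha> (A \<union> B)"
  using rank_le_Union[of "{A, B}" le \<alpha>] by auto

lemma rank_le_singleton: "rank_le le \<alpha> {x}"
  by (rule locally_less_imp_rank_le) (auto simp: locally_less_def)

lemma rank_less_empty: "\<beta> < \<alpha> \<Longrightarrow> rank_less le \<alpha> {}"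
  unfolding rank_less_def rank_le_iff by (intro exI[of _ \<beta>] conjI exI[of _ "{}"]) auto

lemma rank_less_Un:
  assumes "rank_less le \<alpha> A" "rank_less le \<alpha> B"
  shows "rank_less le \<alpha> (A \<union> B)"
proof -
  from assms obtain \<beta> \<gamma> where "\<beta> < \<alpha>" "\<gamma> < \<alpha>" "rank_le le \<beta> A" "rank_le le \<gamma> B"
    unfolding rank_less_def by blast
  then have "rank_le le (max \<beta> \<gamma>) (A \<union> B)" "max \<beta> \<gamma> < \<alpha>"
    by (auto intro!: rank_le_Un elim: rank_le_mono)
  then show ?thesis unfolding rank_less_def by blast
qed

lemma rank_less_Union:
  assumes "finite G" "\<And>A. A \<in> G \<Longrightarrow> rank_less le \<alpha> A" "\<beta> < \<alpha>"
  shows "rank_less le \<alpha> (\<Union>G)"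
  using assms(1,2) by (induction G) (auto intro: rank_less_Un rank_less_empty[OF assms(3)])

section \<open>Linear orders on products\<close>

text \<open>Since \<open>b\<close> is least, the initial segment up to \<open>m\<close> is the
  interval from \<open>b\<close> to \<open>m\<close>. The index \<open>\<alpha>\<^sub>0\<close>
  serves the case \<open>b = m\<close>, where the segment is a single point.\<close>

lemma locally_less_initial:
  assumes "lin_on B le" "locally_less le \<alpha> B" "b \<in> B" "\<And>x. x \<in> B \<Longrightarrow> le b x" "m \<in> B" "\<alpha>\<^sub>0 < \<alpha>"
  shows "rank_less le \<alpha> {x\<in>B. le x m}"
proof (cases "b = m")
  case True
  then have "{x\<in>B. le x m} \<subseteq> {b}" using assms lin_on_antisym[OF assms(1)] by blast
  moreover have "rank_less le \<alpha> {b}"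
    unfolding rank_less_def by (rule exI[of _ "\<alpha>\<^sub>0"]) (simp add: assms(6) rank_le_singleton)
  ultimately show ?thesis by (blast intro: rank_less_subset)
next
  case False
  then have "rank_less le \<alpha> {x\<in>B. le b x \<and> le x m}"
    using assms(2-5) unfolding locally_less_def by blast
  then show ?thesis by (rule rank_less_subset) (use assms(4) in auto)
qed

lemma locally_less_final:
  assumes "lin_on B le" "locally_less le \<alpha> B" "b \<in> B" "\<And>x. x \<in> B \<Longrightarrow> le x b" "m \<in> B" "\<alpha>\<^sub>0 < \<alpha>"
  shows "rank_less le \<alpha> {x\<in>B. le m x}"
  using rank_less_converse[OF locally_less_initial[OF lin_on_converse[OF assms(1)]
    locally_less_converse[OF assms(2)] assms(3-6)]] .

text \<open>If every colour were bounded, the largest of the finitely many bounds \<open>h a\<close>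
  would be an upper bound of \<open>B\<close>.\<close>

lemma cofinal_pigeonhole:
  assumes lin: "lin_on B le" and ne: "B \<noteq> {}"
    and unb: "\<And>w. w \<in> B \<Longrightarrow> \<exists>x\<in>B. \<not> le x w"
    and fin: "finite (g ` B)"
  shows "\<exists>a. \<forall>w\<in>B. \<exists>x\<in>B. \<not> le x w \<and> g x = a"
proof (rule ccontr)
  assume "\<not> ?thesis"
  then obtain h where h: "\<And>a. h a \<in> B" "\<And>a x. x \<in> B \<Longrightarrow> g x = a \<Longrightarrow> le x (h a)" by metis
  have "\<exists>w\<in>B. \<forall>a\<in>S. le (h a) w" if "finite S" for S
    using that
  proof (induction S)
    case empty
    then show ?case using ne by blast
  next
    case (insert a S)
    then obtain w where w: "w \<in> B" "\<forall>a\<in>S. le (h a) w" by blast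
    show ?case
    proof (cases "le w (h a)")
      case True
      then show ?thesis using w h(1) lin_on_trans[OF lin] lin_on_refl[OF lin]
        by (intro bexI[of _ "h a"]) (metis insert_iff)+
    next
      case False
      then show ?thesis using w h(1) lin_on_linear[OF lin] by (intro bexI[of _ w]) (metis insert_iff)+
    qed
  qed
  from this[OF fin] obtain w where w: "w \<in> B" "\<forall>a\<in>g ` B. le (h a) w" by blast
  have "le x w" if "x \<in> B" for x
    using w that lin_on_trans[OF lin, of x "h (g x)" w] by (simp add: h)
  then show False using unb[OF w(1)] by blast
qed

section \<open>Products of two factors with finite colourings\<close>

text \<open>The product carries a linear extension of the product order. The order on a line
  parallel to a factor does not depend on the line, and finitely many colours of pairs decide all
  comparisons through \<open>P\<close>. For trees, the colours are the values that the automaton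
  assigns to convolutions.\<close>

locale box =
  fixes L\<^sub>1 :: "'a set" and L\<^sub>2 :: "'b set" and le :: "'a \<times> 'b \<Rightarrow> 'a \<times> 'b \<Rightarrow> bool"
    and le\<^sub>1 le\<^sub>2 and c\<^sub>1 :: "'a \<Rightarrow> 'a \<Rightarrow> 'c" and c\<^sub>2 :: "'b \<Rightarrow> 'b \<Rightarrow> 'd" and K\<^sub>1 K\<^sub>2 P
  assumes lin: "lin_on (L\<^sub>1 \<times> L\<^sub>2) le"
    and le\<^sub>1: "\<lbrakk>x \<in> L\<^sub>1; x' \<in> L\<^sub>1; y \<in> L\<^sub>2\<rbrakk> \<Longrightarrow> le (x, y) (x', y) \<longleftrightarrow> le\<^sub>1 x x'"
    and le\<^sub>2: "\<lbrakk>x \<in> L\<^sub>1; y \<in> L\<^sub>2; y' \<in> L\<^sub>2\<rbrakk> \<Longrightarrow> le (x, y) (x, y') \<longleftrightarrow> le\<^sub>2 y y'"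
    and colour: "\<lbrakk>x \<in> L\<^sub>1; x' \<in> L\<^sub>1; y \<in> L\<^sub>2; y' \<in> L\<^sub>2\<rbrakk> \<Longrightarrow>
      le (x, y) (x', y') \<longleftrightarrow> P (c\<^sub>1 x x') (c\<^sub>2 y y')"
    and colours: "finite K\<^sub>1" "finite K\<^sub>2"
      "\<lbrakk>x \<in> L\<^sub>1; x' \<in> L\<^sub>1\<rbrakk> \<Longrightarrow> c\<^sub>1 x x' \<in> K\<^sub>1" "\<lbrakk>y \<in> L\<^sub>2; y' \<in> L\<^sub>2\<rbrakk> \<Longrightarrow> c\<^sub>2 y y' \<in> K\<^sub>2"
begin

lemma box_subset: "B \<subseteq> L\<^sub>1 \<Longrightarrow> C \<subseteq> L\<^sub>2 \<Longrightarrow> box B C le le\<^sub>1 le\<^sub>2 c\<^sub>1 c\<^sub>2 K\<^sub>1 K\<^sub>2 P"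
  by unfold_locales (rule lin_on_subset[OF lin] le\<^sub>1 le\<^sub>2 colour colours; blast)+

text \<open>Reversal and the exchange of factors in \<open>box_swap\<close> are the symmetries that
  reduce the four combinations of least and greatest points below to two.\<close>

lemma box_converse:
  "box L\<^sub>1 L\<^sub>2 (\<lambda>p q. le q p) (\<lambda>x y. le\<^sub>1 y x) (\<lambda>x y. le\<^sub>2 y x) (\<lambda>x y. c\<^sub>1 y x) (\<lambda>x y. c\<^sub>2 y x) K\<^sub>1 K\<^sub>2 P"
  by unfold_locales (rule lin_on_converse[OF lin] le\<^sub>1 le\<^sub>2 colour colours; assumption)+

lemma box_swap:
  "box L\<^sub>2 L\<^sub>1 (\<lambda>p q. le (prod.swap p) (prod.swap q)) le\<^sub>2 le\<^sub>1 c\<^sub>2 c\<^sub>1 K\<^sub>2 K\<^sub>1 (\<lambda>a b. P b a)"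
proof unfold_locales
  show "lin_on (L\<^sub>2 \<times> L\<^sub>1) (\<lambda>p q. le (prod.swap p) (prod.swap q))"
    by (rule lin_on_pullback[OF lin, of prod.swap]) auto
qed (unfold swap_simp, (rule le\<^sub>1 le\<^sub>2 colour colours; assumption)+)

lemma lin\<^sub>1: "L\<^sub>2 \<noteq> {} \<Longrightarrow> lin_on L\<^sub>1 le\<^sub>1"
proof (erule ex_in_conv[THEN iffD2, THEN exE])
  fix y assume "y \<in> L\<^sub>2"
  then show ?thesis
    by (intro lin_on_pullback[OF lin, of "\<lambda>x. (x, y)"]) (auto simp: le\<^sub>1 inj_on_def)
qed

lemma lin\<^sub>2: "L\<^sub>1 \<noteq> {} \<Longrightarrow> lin_on L\<^sub>2 le\<^sub>2"
  by (rule box.lin\<^sub>1[OF box_swap])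

lemma le_prodI:
  assumes "x \<in> L\<^sub>1" "x' \<in> L\<^sub>1" "y \<in> L\<^sub>2" "y' \<in> L\<^sub>2" "le\<^sub>1 x x'" "le\<^sub>2 y y'"
  shows "le (x, y) (x', y')"
proof (rule lin_on_trans[OF lin])
  show "le (x, y) (x', y)" "le (x', y) (x', y')" using assms le\<^sub>1 le\<^sub>2 by simp_all
qed (use assms in auto)

text \<open>If both alternatives fail, \<open>le_prodI\<close> gives the reverse comparison and
  antisymmetry identifies the points. Hence everything below \<open>(x', y')\<close> lies in the
  union of two strips, one over the points up to \<open>x'\<close>, one over those up to
  \<open>y'\<close>.\<close>

lemma le_prodD:
  assumes "x \<in> L\<^sub>1" "x' \<in> L\<^sub>1" "y \<in> L\<^sub>2" "y' \<in> L\<^sub>2" "le (x, y) (x', y')"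
  shows "le\<^sub>1 x x' \<or> le\<^sub>2 y y'"
proof (rule ccontr)
  assume *: "\<not> ?thesis"
  then have "le\<^sub>1 x' x" "le\<^sub>2 y' y"
    using assms lin_on_linear[OF lin\<^sub>1] lin_on_linear[OF lin\<^sub>2] by blast+
  then have "le (x', y') (x, y)" using assms by (intro le_prodI)
  then have "x = x'" using assms lin_on_antisym[OF lin, of "(x, y)" "(x', y')"] by simp
  then show False using * assms lin_on_refl[OF lin\<^sub>1] by blast
qed

text \<open>In the application \<open>\<gamma> = \<alpha> + \<beta>\<close>; the two assumptions on rectangles with a smaller
  side are the induction hypothesis.\<close>

context
  fixes \<alpha> \<beta> \<gamma> \<alpha>\<^sub>0 \<beta>\<^sub>0 :: "'o::wellorder"
  assumes small\<^sub>1: "\<And>B. B \<subseteq> L\<^sub>1 \<Longrightarrow> rank_less le\<^sub>1 \<alpha> B \<Longrightarrow> rank_less le \<gamma> (B \<times> L\<^sub>2)"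
    and small\<^sub>2: "\<And>C. C \<subseteq> L\<^sub>2 \<Longrightarrow> rank_less le\<^sub>2 \<beta> C \<Longrightarrow> rank_less le \<gamma> (L\<^sub>1 \<times> C)"
    and local\<^sub>1: "locally_less le\<^sub>1 \<alpha> L\<^sub>1" and local\<^sub>2: "locally_less le\<^sub>2 \<beta> L\<^sub>2"
    and pos: "\<alpha>\<^sub>0 < \<alpha>" "\<beta>\<^sub>0 < \<beta>"
begin

text \<open>The points below \<open>q\<close> lie in two strips over initial segments. Since both
  factors have a least point, these segments have smaller rank, so that \<open>small\<^sub>1\<close>
  and \<open>small\<^sub>2\<close> apply.\<close>

lemma rank_le_least_least:
  assumes b: "b \<in> L\<^sub>1" "\<And>x. x \<in> L\<^sub>1 \<Longrightarrow> le\<^sub>1 b x" and c: "c \<in> L\<^sub>2" "\<And>y. y \<in> L\<^sub>2 \<Longrightarrow> le\<^sub>2 c y"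
  shows "rank_le le \<gamma> (L\<^sub>1 \<times> L\<^sub>2)"
proof (rule locally_less_imp_rank_le, unfold locally_less_def, intro ballI impI)
  fix p q assume pq: "p \<in> L\<^sub>1 \<times> L\<^sub>2" "q \<in> L\<^sub>1 \<times> L\<^sub>2" "p \<noteq> q" "le p q"
  obtain x y where q: "q = (x, y)" "x \<in> L\<^sub>1" "y \<in> L\<^sub>2" using pq by blast
  let ?B = "{u\<in>L\<^sub>1. le\<^sub>1 u x}" and ?C = "{v\<in>L\<^sub>2. le\<^sub>2 v y}"
  have "rank_less le\<^sub>1 \<alpha> ?B"
    by (rule locally_less_initial[OF lin\<^sub>1 local\<^sub>1 b q(2) pos(1)]) (use c in auto)
  moreover have "rank_less le\<^sub>2 \<beta> ?C"
    by (rule locally_less_initial[OF lin\<^sub>2 local\<^sub>2 c q(3) pos(2)]) (use b in auto)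
  ultimately have "rank_less le \<gamma> (?B \<times> L\<^sub>2 \<union> L\<^sub>1 \<times> ?C)"
    by (intro rank_less_Un small\<^sub>1 small\<^sub>2) auto
  then show "rank_less le \<gamma> {z \<in> L\<^sub>1 \<times> L\<^sub>2. le p z \<and> le z q}"
    by (rule rank_less_subset) (use q le_prodD in auto)
qed

text \<open>Dominance of the first coordinate: beyond every point of row \<open>y\<close> there is a
  column none of whose points lies below it. Cut the second factor at \<open>y\<close>. The part
  above \<open>y\<close> is a final segment and therefore small. Below \<open>y\<close>, every
  \<open>q\<close> is below some \<open>(x, y)\<close>, and dominance confines the points below
  \<open>q\<close> to the columns up to \<open>x'\<close>, a strip over an initial segment.\<close>

lemma rank_le_dominant:
  assumes b: "b \<in> L\<^sub>1" "\<And>x. x \<in> L\<^sub>1 \<Longrightarrow> le\<^sub>1 b x" and c: "c \<in> L\<^sub>2" "\<And>y. y \<in> L\<^sub>2 \<Longrightarrow> le\<^sub>2 y c"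
    and y: "y \<in> L\<^sub>2"
    and dom: "\<And>x. x \<in> L\<^sub>1 \<Longrightarrow> \<exists>x'\<in>L\<^sub>1. \<forall>y'\<in>L\<^sub>2. \<not> le (x', y') (x, y)"
  shows "rank_le le \<gamma> (L\<^sub>1 \<times> L\<^sub>2)"
proof -
  let ?C = "{v\<in>L\<^sub>2. le\<^sub>2 v y}" and ?C' = "{v\<in>L\<^sub>2. le\<^sub>2 y v}"
  have "rank_less le\<^sub>2 \<beta> ?C'"
    by (rule locally_less_final[OF lin\<^sub>2 local\<^sub>2 c y pos(2)]) (use b in auto)
  then have 1: "rank_le le \<gamma> (L\<^sub>1 \<times> ?C')" by (intro rank_less_imp_le small\<^sub>2) auto
  have 2: "rank_le le \<gamma> (L\<^sub>1 \<times> ?C)"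
  proof (rule locally_less_imp_rank_le, unfold locally_less_def, intro ballI impI)
    fix p q assume pq: "p \<in> L\<^sub>1 \<times> ?C" "q \<in> L\<^sub>1 \<times> ?C" "p \<noteq> q" "le p q"
    obtain x w where q: "q = (x, w)" "x \<in> L\<^sub>1" "w \<in> L\<^sub>2" "le\<^sub>2 w y" using pq by blast
    then have qy: "le q (x, y)" using y le\<^sub>2 by simp
    obtain x' where x': "x' \<in> L\<^sub>1" "\<forall>y'\<in>L\<^sub>2. \<not> le (x', y') (x, y)" using dom q(2) by blast
    let ?B = "{u\<in>L\<^sub>1. le\<^sub>1 u x'}"
    have "rank_less le\<^sub>1 \<alpha> ?B"
      by (rule locally_less_initial[OF lin\<^sub>1 local\<^sub>1 b x'(1) pos(1)]) (use c in auto)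
    then have "rank_less le \<gamma> (?B \<times> L\<^sub>2)" by (intro small\<^sub>1) auto
    then show "rank_less le \<gamma> {z \<in> L\<^sub>1 \<times> ?C. le p z \<and> le z q}"
    proof (rule rank_less_subset, intro subsetI)
      fix z assume "z \<in> {z \<in> L\<^sub>1 \<times> ?C. le p z \<and> le z q}"
      then obtain u v where *: "z = (u, v)" "u \<in> L\<^sub>1" "v \<in> L\<^sub>2" "le (u, v) q" by blast
      have "le\<^sub>1 u x'"
      proof (rule ccontr)
        assume "\<not> le\<^sub>1 u x'"
        then have "le\<^sub>1 x' u" using lin_on_linear[OF lin\<^sub>1] * x' by blast
        then have "le (x', v) (u, v)" using le\<^sub>1 * x' by simp
        then have "le (x', v) q" using lin_on_trans[OF lin, of _ "(u, v)"] * q x' by blast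
        then have "le (x', v) (x, y)" using lin_on_trans[OF lin _ qy] * q x' y by blast
        then show False using x' * by blast
      qed
      then show "z \<in> ?B \<times> L\<^sub>2" using * by blast
    qed
  qed
  have "L\<^sub>1 \<times> L\<^sub>2 = L\<^sub>1 \<times> ?C \<union> L\<^sub>1 \<times> ?C'" using lin_on_linear[OF lin\<^sub>2] b y by blast
  with rank_le_Un[OF 2 1] show ?thesis by simp
qed

text \<open>Reversing the order turns greatest points into least ones and preserves the assumptions
  on ranks.\<close>

lemma rank_le_greatest_greatest:
  assumes b: "b \<in> L\<^sub>1" "\<And>x. x \<in> L\<^sub>1 \<Longrightarrow> le\<^sub>1 x b" and c: "c \<in> L\<^sub>2" "\<And>y. y \<in> L\<^sub>2 \<Longrightarrow> le\<^sub>2 y c"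
  shows "rank_le le \<gamma> (L\<^sub>1 \<times> L\<^sub>2)"
proof -
  have "rank_le (\<lambda>p q. le q p) \<gamma> (L\<^sub>1 \<times> L\<^sub>2)"
  proof (rule box.rank_le_least_least[OF box_converse _ _ locally_less_converse[OF local\<^sub>1]
        locally_less_converse[OF local\<^sub>2] pos b c])
    fix B assume "B \<subseteq> L\<^sub>1" "rank_less (\<lambda>x y. le\<^sub>1 y x) \<alpha> B"
    then show "rank_less (\<lambda>p q. le q p) \<gamma> (B \<times> L\<^sub>2)"
      using rank_less_converse[of "\<lambda>x y. le\<^sub>1 y x"] by (intro rank_less_converse[of le] small\<^sub>1)
  next
    fix C assume "C \<subseteq> L\<^sub>2" "rank_less (\<lambda>x y. le\<^sub>2 y x) \<beta> C"
    then show "rank_less (\<lambda>p q. le q p) \<gamma> (L\<^sub>1 \<times> C)"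
      using rank_less_converse[of "\<lambda>x y. le\<^sub>2 y x"] by (intro rank_less_converse[of le] small\<^sub>2)
  qed
  from rank_le_converse[OF this] show ?thesis .
qed

text \<open>The critical case. If the claim fails, neither coordinate dominates the other. For
  colours that recur cofinally in the first factor and coinitially in the second, failure of one
  dominance forces \<open>P\<close> to reject the pair of colours, failure of the other forces
  \<open>P\<close> to accept it.\<close>

lemma rank_le_least_greatest:
  assumes b: "b \<in> L\<^sub>1" "\<And>x. x \<in> L\<^sub>1 \<Longrightarrow> le\<^sub>1 b x" and c: "c \<in> L\<^sub>2" "\<And>y. y \<in> L\<^sub>2 \<Longrightarrow> le\<^sub>2 y c"
  shows "rank_le le \<gamma> (L\<^sub>1 \<times> L\<^sub>2)"
proof (rule ccontr)
  assume contra: "\<not> ?thesis"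
  have lin1: "lin_on L\<^sub>1 le\<^sub>1" and lin2: "lin_on L\<^sub>2 le\<^sub>2" using lin\<^sub>1 lin\<^sub>2 b c by auto
  \<comment> \<open>With an upper bound, \<open>L\<^sub>1\<close> would be an initial segment of
    itself of smaller rank, and \<open>small\<^sub>1\<close> would yield the claim.
    \<open>unb2\<close> is dual.\<close>
  have unb1: "\<exists>x\<in>L\<^sub>1. \<not> le\<^sub>1 x w" if "w \<in> L\<^sub>1" for w
  proof (rule ccontr)
    assume "\<not> ?thesis"
    then have "L\<^sub>1 = {x\<in>L\<^sub>1. le\<^sub>1 x w}" by blast
    moreover have "rank_less le\<^sub>1 \<alpha> {x\<in>L\<^sub>1. le\<^sub>1 x w}"
      by (rule locally_less_initial[OF lin1 local\<^sub>1 b that pos(1)])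
    ultimately have "rank_less le \<gamma> (L\<^sub>1 \<times> L\<^sub>2)" using small\<^sub>1[of L\<^sub>1] by simp
    then show False using contra rank_less_imp_le by blast
  qed
  have unb2: "\<exists>y\<in>L\<^sub>2. \<not> le\<^sub>2 w y" if "w \<in> L\<^sub>2" for w
  proof (rule ccontr)
    assume "\<not> ?thesis"
    then have "L\<^sub>2 = {y\<in>L\<^sub>2. le\<^sub>2 w y}" by blast
    moreover have "rank_less le\<^sub>2 \<beta> {y\<in>L\<^sub>2. le\<^sub>2 w y}"
      by (rule locally_less_final[OF lin2 local\<^sub>2 c that pos(2)])
    ultimately have "rank_less le \<gamma> (L\<^sub>1 \<times> L\<^sub>2)" using small\<^sub>2[of L\<^sub>2] by simp
    then show False using contra rank_less_imp_le by blast
  qed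
  \<comment> \<open>By \<open>rank_le_dominant\<close>, dominance fails at every row
    \<open>y\<close>: every column contains a point below \<open>(X y, y)\<close>.\<close>
  have "\<exists>x\<in>L\<^sub>1. \<forall>x'\<in>L\<^sub>1. \<exists>y'\<in>L\<^sub>2. le (x', y') (x, y)" if "y \<in> L\<^sub>2" for y
    using contra rank_le_dominant[OF b c that] by blast
  then obtain X where X: "\<And>y. y \<in> L\<^sub>2 \<Longrightarrow> X y \<in> L\<^sub>1"
    "\<And>y x'. y \<in> L\<^sub>2 \<Longrightarrow> x' \<in> L\<^sub>1 \<Longrightarrow> \<exists>y'\<in>L\<^sub>2. le (x', y') (X y, y)" by metis
  have "\<exists>y\<in>L\<^sub>2. \<forall>y'\<in>L\<^sub>2. \<exists>x'\<in>L\<^sub>1. le (x, y) (x', y')" if x: "x \<in> L\<^sub>1" for x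
  proof (rule ccontr)
    assume neg: "\<not> ?thesis"
    \<comment> \<open>Exchanging the factors and reversing the order at once leads again to a least
      point in the first and a greatest point in the second factor, so
      \<open>rank_le_dominant\<close> applies to the other coordinate.\<close>
    let ?le = "\<lambda>p q. le (prod.swap q) (prod.swap p)"
    have swap: "rank_less ?le \<gamma> (C \<times> B)" if "rank_less le \<gamma> (B \<times> C)" for B C
      by (rule rank_less_converse, rule rank_less_embed[OF that, of prod.swap]) auto
    have "rank_le ?le \<gamma> (L\<^sub>2 \<times> L\<^sub>1)"
    proof (rule box.rank_le_dominant[OF box.box_swap[OF box_converse] _ _
          locally_less_converse[OF local\<^sub>2] locally_less_converse[OF local\<^sub>1] pos(2,1) c b x])
      fix C assume "C \<subseteq> L\<^sub>2" "rank_less (\<lambda>x y. le\<^sub>2 y x) \<beta> C"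
      then show "rank_less ?le \<gamma> (C \<times> L\<^sub>1)"
        using rank_less_converse[of "\<lambda>x y. le\<^sub>2 y x"] by (intro swap small\<^sub>2)
    next
      fix B assume "B \<subseteq> L\<^sub>1" "rank_less (\<lambda>x y. le\<^sub>1 y x) \<alpha> B"
      then show "rank_less ?le \<gamma> (L\<^sub>2 \<times> B)"
        using rank_less_converse[of "\<lambda>x y. le\<^sub>1 y x"] by (intro swap small\<^sub>1)
    next
      fix y assume "y \<in> L\<^sub>2"
      then show "\<exists>y'\<in>L\<^sub>2. \<forall>x'\<in>L\<^sub>1. \<not> le (prod.swap (y, x)) (prod.swap (y', x'))"
        using neg by simp
    qed
    from rank_le_converse[OF this]
    have "rank_le (\<lambda>p q. le (prod.swap p) (prod.swap q)) \<gamma> (L\<^sub>2 \<times> L\<^sub>1)" .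
    then have "rank_le le \<gamma> (L\<^sub>1 \<times> L\<^sub>2)"
      by (rule rank_le_embed[where f = prod.swap]) auto
    then show False using contra by blast
  qed
  then obtain Y where Y: "\<And>x. x \<in> L\<^sub>1 \<Longrightarrow> Y x \<in> L\<^sub>2"
    "\<And>x y'. x \<in> L\<^sub>1 \<Longrightarrow> y' \<in> L\<^sub>2 \<Longrightarrow> \<exists>x'\<in>L\<^sub>1. le (x, Y x) (x', y')" by metis
  \<comment> \<open>\<open>e x\<close> collects the colours from \<open>x\<close> that recur
    arbitrarily high in \<open>L\<^sub>1\<close>, \<open>f y\<close> those from \<open>y\<close>
    that recur arbitrarily low in \<open>L\<^sub>2\<close>.\<close>
  define e where "e x = {a. \<forall>w\<in>L\<^sub>1. \<exists>x'\<in>L\<^sub>1. \<not> le\<^sub>1 x' w \<and> c\<^sub>1 x x' = a}" for x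
  define f where "f y = {a. \<forall>w\<in>L\<^sub>2. \<exists>y'\<in>L\<^sub>2. \<not> le\<^sub>2 w y' \<and> c\<^sub>2 y y' = a}" for y
  have e: "e x \<noteq> {}" "e x \<subseteq> K\<^sub>1" if "x \<in> L\<^sub>1" for x
  proof -
    have "finite (c\<^sub>1 x ` L\<^sub>1)" using colours that by (auto intro: finite_subset[OF _ colours(1)])
    then show "e x \<noteq> {}" using cofinal_pigeonhole[OF lin1 _ unb1] b unfolding e_def by blast
    show "e x \<subseteq> K\<^sub>1" unfolding e_def using b colours that by blast
  qed
  have f: "f y \<noteq> {}" "f y \<subseteq> K\<^sub>2" if "y \<in> L\<^sub>2" for y
  proof -
    have "finite (c\<^sub>2 y ` L\<^sub>2)" using colours that by (auto intro: finite_subset[OF _ colours(2)])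
    then show "f y \<noteq> {}"
      using cofinal_pigeonhole[OF lin_on_converse[OF lin2] _ unb2] c unfolding f_def by blast
    show "f y \<subseteq> K\<^sub>2" unfolding f_def using c colours that by blast
  qed
  \<comment> \<open>Pigeonhole once more, now on sets of colours: some value \<open>E\<close> of
    \<open>e\<close> recurs cofinally and some value \<open>F\<close> of \<open>f\<close>
    coinitially.\<close>
  have "finite (e ` L\<^sub>1)" using e colours by (auto intro: finite_subset[of _ "Pow K\<^sub>1"])
  then obtain E where E: "\<forall>w\<in>L\<^sub>1. \<exists>x\<in>L\<^sub>1. \<not> le\<^sub>1 x w \<and> e x = E"
    using cofinal_pigeonhole[OF lin1 _ unb1, of e] b by blast
  have "finite (f ` L\<^sub>2)" using f colours by (auto intro: finite_subset[of _ "Pow K\<^sub>2"])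
  then obtain F where F: "\<forall>w\<in>L\<^sub>2. \<exists>y\<in>L\<^sub>2. \<not> le\<^sub>2 w y \<and> f y = F"
    using cofinal_pigeonhole[OF lin_on_converse[OF lin2] _ unb2, of f] c by blast
  \<comment> \<open>Take \<open>x'\<close> with colour \<open>a\<close>, then \<open>y1\<close> with
    \<open>(x', y1)\<close> below \<open>(X y, y)\<close>, then \<open>y'\<close> strictly below
    \<open>y1\<close> with colour \<open>a'\<close>. If \<open>P\<close> accepted the colours,
    \<open>(x', y1)\<close> would lie below \<open>(x', y')\<close>.\<close>
  have neg: "\<not> P a a'" if *: "x \<in> L\<^sub>1" "y \<in> L\<^sub>2" "le\<^sub>1 (X y) x" "a \<in> e x" "a' \<in> f y" for x y a a'
  proof
    assume P: "P a a'"
    obtain x' where x': "x' \<in> L\<^sub>1" "c\<^sub>1 x x' = a" using * unfolding e_def by blast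
    obtain y1 where y1: "y1 \<in> L\<^sub>2" "le (x', y1) (X y, y)" using X * x' by blast
    obtain y' where y': "y' \<in> L\<^sub>2" "\<not> le\<^sub>2 y1 y'" "c\<^sub>2 y y' = a'"
      using * y1 unfolding f_def by blast
    have "le (x, y) (x', y')" using colour * x' y' P by simp
    moreover have "le (X y, y) (x, y)" using le\<^sub>1 X * by simp
    ultimately have "le (x', y1) (x', y')"
      using y1 lin_on_trans[OF lin] X * x' y' by (metis mem_Sigma_iff)
    then show False using le\<^sub>2 x' y1 y' by simp
  qed
  \<comment> \<open>Dually, \<open>y'\<close> is taken first, then \<open>x1\<close> with
    \<open>(x1, y')\<close> above \<open>(x, Y x)\<close>, and last \<open>x'\<close> above
    \<open>x1\<close> with colour \<open>a\<close>.\<close>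
  have pos: "P a a'" if *: "x \<in> L\<^sub>1" "y \<in> L\<^sub>2" "le\<^sub>2 y (Y x)" "a \<in> e x" "a' \<in> f y" for x y a a'
  proof -
    obtain y' where y': "y' \<in> L\<^sub>2" "c\<^sub>2 y y' = a'" using * unfolding f_def by blast
    obtain x1 where x1: "x1 \<in> L\<^sub>1" "le (x, Y x) (x1, y')" using Y * y' by blast
    obtain x' where x': "x' \<in> L\<^sub>1" "\<not> le\<^sub>1 x' x1" "c\<^sub>1 x x' = a"
      using * x1 unfolding e_def by blast
    have "le (x1, y') (x', y')" using le\<^sub>1 x' x1 y' lin_on_linear[OF lin1] by blast
    moreover have "le (x, y) (x, Y x)" using le\<^sub>2 Y * by simp
    ultimately have "le (x, y) (x', y')"
      using x1 lin_on_trans[OF lin] Y * x' y' by (metis mem_Sigma_iff)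
    then show ?thesis using colour * x' y' by simp
  qed
  \<comment> \<open>The order of the choices matters: \<open>y\<close>, then \<open>x\<close> beyond
    \<open>X y\<close>, then \<open>y'\<close> below \<open>Y x\<close>. As \<open>y\<close> and
    \<open>y'\<close> share the colour set \<open>F\<close>, the same pair of colours is rejected
    and accepted.\<close>
  obtain y where y: "y \<in> L\<^sub>2" "f y = F" using F c by blast
  obtain x where x: "x \<in> L\<^sub>1" "le\<^sub>1 (X y) x" "e x = E"
    using E X(1)[OF y(1)] lin_on_linear[OF lin1] by metis
  obtain y' where y': "y' \<in> L\<^sub>2" "le\<^sub>2 y' (Y x)" "f y' = F"
    using F Y(1)[OF x(1)] lin_on_linear[OF lin2] by metis
  obtain a a' where "a \<in> E" "a' \<in> F" using e(1)[OF x(1)] f(1)[OF y(1)] x y by blast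
  then show False using neg[of x y a a'] pos[of x y' a a'] x y y' by blast
qed

lemma rank_le_greatest_least:
  assumes b: "b \<in> L\<^sub>1" "\<And>x. x \<in> L\<^sub>1 \<Longrightarrow> le\<^sub>1 x b" and c: "c \<in> L\<^sub>2" "\<And>y. y \<in> L\<^sub>2 \<Longrightarrow> le\<^sub>2 c y"
  shows "rank_le le \<gamma> (L\<^sub>1 \<times> L\<^sub>2)"
proof -
  let ?le = "\<lambda>p q. le (prod.swap p) (prod.swap q)"
  have swap: "rank_less ?le \<gamma> (C \<times> B)" if "rank_less le \<gamma> (B \<times> C)" for B C
    by (rule rank_less_embed[OF that, of prod.swap]) auto
  have "rank_le ?le \<gamma> (L\<^sub>2 \<times> L\<^sub>1)"
    by (rule box.rank_le_least_greatest[OF box_swap _ _ local\<^sub>2 local\<^sub>1 pos(2,1) c b])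
      (auto intro: swap small\<^sub>1 small\<^sub>2)
  then show ?thesis by (rule rank_le_embed[where f = prod.swap]) auto
qed

end

end

section \<open>Hessenberg sums as bounds for products\<close>

text \<open>No index lies below \<open>{#}\<close>, so the interval between two distinct points
  could not satisfy the condition.\<close>

lemma locally_less_empty_mset:
  fixes B :: "'a set"
  assumes "lin_on B le" "locally_less le ({#} :: 'o::wellorder multiset) B" "b \<in> B"
  shows "B = {b}"
proof (rule ccontr)
  assume "B \<noteq> {b}"
  then obtain x where x: "x \<in> B" "x \<noteq> b" using assms(3) by blast
  have "\<not> rank_less le ({#} :: 'o multiset) C" for C :: "'a set" by (simp add: rank_less_def)
  then show False
    using assms(2,3) x lin_on_linear[OF assms(1) x(1) assms(3)] unfolding locally_less_def by metis
qed

text \<open>The addition of \<open>nat multiset\<close> is the Hessenberg sum of the ordinals below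
  \<open>\<omega>\<^sup>\<omega>\<close>.\<close>

theorem rank_le_box:
  fixes \<alpha> \<beta> :: "'o::wellorder multiset"
  assumes "box L\<^sub>1 L\<^sub>2 le le\<^sub>1 le\<^sub>2 c\<^sub>1 c\<^sub>2 K\<^sub>1 K\<^sub>2 P" "rank_le le\<^sub>1 \<alpha> L\<^sub>1" "rank_le le\<^sub>2 \<beta> L\<^sub>2"
  shows "rank_le le (\<alpha> + \<beta>) (L\<^sub>1 \<times> L\<^sub>2)"
  using assms
proof (induction "\<alpha> + \<beta>" arbitrary: \<alpha> \<beta> L\<^sub>1 L\<^sub>2 rule: less_induct)
  case (less \<alpha> \<beta> L\<^sub>1 L\<^sub>2)
  note box = less.prems(1)
  obtain F\<^sub>1 where F1: "finite F\<^sub>1" "L\<^sub>1 = \<Union>F\<^sub>1" "\<And>B. B \<in> F\<^sub>1 \<Longrightarrow> locally_less le\<^sub>1 \<alpha> B"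
    using less.prems(2) unfolding rank_le_iff by blast
  obtain F\<^sub>2 where F2: "finite F\<^sub>2" "L\<^sub>2 = \<Union>F\<^sub>2" "\<And>C. C \<in> F\<^sub>2 \<Longrightarrow> locally_less le\<^sub>2 \<beta> C"
    using less.prems(3) unfolding rank_le_iff by blast
  have piece: "rank_le le (\<alpha> + \<beta>) (B \<times> C)" if BC: "B \<in> F\<^sub>1" "C \<in> F\<^sub>2" for B C
  proof -
    have sub: "B \<subseteq> L\<^sub>1" "C \<subseteq> L\<^sub>2" using BC F1 F2 by auto
    note loc = F1(3)[OF BC(1)] F2(3)[OF BC(2)]
    note boxBC = box.box_subset[OF box sub]
    show ?thesis
    proof (cases "B = {} \<or> C = {}")
      case True
      then show ?thesis using rank_le_subset[OF rank_le_singleton[of le "\<alpha> + \<beta>" undefined]] by auto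
    next
      case False
      then obtain b c where bc: "b \<in> B" "c \<in> C" by blast
      have lin1: "lin_on B le\<^sub>1" and lin2: "lin_on C le\<^sub>2"
        using box.lin\<^sub>1[OF boxBC] box.lin\<^sub>2[OF boxBC] False by auto
      \<comment> \<open>At index \<open>{#}\<close> a piece is a single point and the product is a
        copy of the other piece. Otherwise both indices are positive, as the four corner lemmas
        require.\<close>
      consider "\<alpha> = {#}" | "\<beta> = {#}" | "{#} < \<alpha>" "{#} < \<beta>" by fastforce
      then show ?thesis
      proof cases
        case 1
        then have "B = {b}"
          by (intro locally_less_empty_mset[OF lin1] bc) (use loc in simp)
        then have "rank_le le \<beta> (B \<times> C)"
          using bc box.le\<^sub>2[OF boxBC]
          by (intro rank_le_embed[OF locally_less_imp_rank_le[OF loc(2)], of snd])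
            (auto simp: inj_on_def)
        then show ?thesis using 1 by simp
      next
        case 2
        then have "C = {c}"
          by (intro locally_less_empty_mset[OF lin2] bc) (use loc in simp)
        then have "rank_le le \<alpha> (B \<times> C)"
          using bc box.le\<^sub>1[OF boxBC]
          by (intro rank_le_embed[OF locally_less_imp_rank_le[OF loc(1)], of fst])
            (auto simp: inj_on_def)
        then show ?thesis using 2 by simp
      next
        case 3
        note pos = this
        \<comment> \<open>Cutting the pieces at \<open>b\<close> and \<open>c\<close> gives four
          quadrants, each with an end point in both factors.\<close>
        let ?B1 = "{x\<in>B. le\<^sub>1 b x}" and ?B2 = "{x\<in>B. le\<^sub>1 x b}"
        let ?C1 = "{y\<in>C. le\<^sub>2 c y}" and ?C2 = "{y\<in>C. le\<^sub>2 y c}"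
        \<comment> \<open>A smaller index in one factor makes the sum strictly smaller, so the
          induction hypothesis applies. The claim covers all subrectangles because each quadrant
          needs it.\<close>
        have small1: "rank_less le (\<alpha> + \<beta>) (B' \<times> C')"
          if sub': "B' \<subseteq> B" "C' \<subseteq> C" "rank_less le\<^sub>1 \<alpha> B'" for B' C'
        proof -
          obtain \<alpha>' where \<alpha>': "\<alpha>' < \<alpha>" "rank_le le\<^sub>1 \<alpha>' B'"
            using sub' unfolding rank_less_def by blast
          moreover have "rank_le le\<^sub>2 \<beta> C'"
            using sub' loc(2) by (blast intro: rank_le_subset locally_less_imp_rank_le)
          ultimately show ?thesis unfolding rank_less_def
            using less.hyps[OF _ box.box_subset[OF boxBC sub'(1,2)]] by (meson add_strict_right_mono)
        qed
        have small2: "rank_less le (\<alpha> + \<beta>) (B' \<times> C')"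
          if sub': "B' \<subseteq> B" "C' \<subseteq> C" "rank_less le\<^sub>2 \<beta> C'" for B' C'
        proof -
          obtain \<beta>' where \<beta>': "\<beta>' < \<beta>" "rank_le le\<^sub>2 \<beta>' C'"
            using sub' unfolding rank_less_def by blast
          moreover have "rank_le le\<^sub>1 \<alpha> B'"
            using sub' loc(1) by (blast intro: rank_le_subset locally_less_imp_rank_le)
          ultimately show ?thesis unfolding rank_less_def
            using less.hyps[OF _ box.box_subset[OF boxBC sub'(1,2)]] by (meson add_strict_left_mono)
        qed
        have bc': "b \<in> ?B1" "b \<in> ?B2" "c \<in> ?C1" "c \<in> ?C2"
          using bc lin_on_refl[OF lin1] lin_on_refl[OF lin2] by auto
        have 1: "rank_le le (\<alpha> + \<beta>) (?B1 \<times> ?C1)"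
          by (rule box.rank_le_least_least[OF box.box_subset[OF boxBC] small1 small2
                locally_less_subset[OF loc(1)] locally_less_subset[OF loc(2)] pos bc'(1) _ bc'(3)]) auto
        have 2: "rank_le le (\<alpha> + \<beta>) (?B1 \<times> ?C2)"
          by (rule box.rank_le_least_greatest[OF box.box_subset[OF boxBC] small1 small2
                locally_less_subset[OF loc(1)] locally_less_subset[OF loc(2)] pos bc'(1) _ bc'(4)]) auto
        have 3: "rank_le le (\<alpha> + \<beta>) (?B2 \<times> ?C1)"
          by (rule box.rank_le_greatest_least[OF box.box_subset[OF boxBC] small1 small2
                locally_less_subset[OF loc(1)] locally_less_subset[OF loc(2)] pos bc'(2) _ bc'(3)]) auto
        have 4: "rank_le le (\<alpha> + \<beta>) (?B2 \<times> ?C2)"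
          by (rule box.rank_le_greatest_greatest[OF box.box_subset[OF boxBC] small1 small2
                locally_less_subset[OF loc(1)] locally_less_subset[OF loc(2)] pos bc'(2) _ bc'(4)]) auto
        have B: "B \<subseteq> ?B1 \<union> ?B2" using lin_on_linear[OF lin1 bc(1)] by blast
        have C: "C \<subseteq> ?C1 \<union> ?C2" using lin_on_linear[OF lin2 bc(2)] by blast
        have "(?B1 \<union> ?B2) \<times> (?C1 \<union> ?C2) = (?B1 \<times> ?C1 \<union> ?B1 \<times> ?C2) \<union> (?B2 \<times> ?C1 \<union> ?B2 \<times> ?C2)"
          by (simp only: Sigma_Un_distrib1 Sigma_Un_distrib2 Un_ac)
        then have "rank_le le (\<alpha> + \<beta>) ((?B1 \<union> ?B2) \<times> (?C1 \<union> ?C2))"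
          by (simp only:) (intro rank_le_Un 1 2 3 4)
        then show ?thesis by (rule rank_le_subset) (intro Sigma_mono B C)
      qed
    qed
  qed
  have "L\<^sub>1 \<times> L\<^sub>2 = \<Union>((\<lambda>(B, C). B \<times> C) ` (F\<^sub>1 \<times> F\<^sub>2))" using F1(2) F2(2) by auto
  also have "rank_le le (\<alpha> + \<beta>) \<dots>" by (rule rank_le_Union) (use F1 F2 piece in auto)
  finally show ?case .
qed

text \<open>Split off one coordinate and apply \<open>rank_le_box\<close>, with vectors of colours
  as colours of the second factor. By the diagonal assumption all other coordinates contribute
  \<open>d\<close> along a line in direction \<open>u\<close>, so the order on the line does not
  depend on its position. The bound survives since \<open>{#k#}\<close>, that is \<omega>^k, is
  closed under sums of smaller multisets.\<close>

lemma rank_less_PiE: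
  fixes k :: "'o::wellorder"
  assumes "finite U" "lin_on (Pi\<^sub>E U T) le"
    and "\<And>f g. f \<in> Pi\<^sub>E U T \<Longrightarrow> g \<in> Pi\<^sub>E U T \<Longrightarrow> le f g \<longleftrightarrow> P (\<lambda>u\<in>U. c (f u) (g u))"
    and K: "finite K" "\<And>u s t. u \<in> U \<Longrightarrow> s \<in> T u \<Longrightarrow> t \<in> T u \<Longrightarrow> c s t \<in> K"
    and diag: "\<And>u s. u \<in> U \<Longrightarrow> s \<in> T u \<Longrightarrow> c s s = d u"
    and "\<And>u. u \<in> U \<Longrightarrow> rank_less (\<lambda>s t. P ((restrict d U)(u := c s t))) {#k#} (T u)"
  shows "rank_less le {#k#} (Pi\<^sub>E U T)"
  using assms
proof (induction U arbitrary: le P rule: finite_induct)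
  case empty
  have "rank_le le {#} (Pi\<^sub>E {} T)" by (simp add: rank_le_singleton)
  then show ?case unfolding rank_less_def by (intro exI[of _ "{#}"]) simp
next
  case (insert u U)
  show ?case
  \<comment> \<open>Linearity of \<open>le\<^sub>2\<close> is read off a line through a point of
    \<open>T u\<close>, so the empty product is treated apart.\<close>
  proof (cases "Pi\<^sub>E (insert u U) T = {}")
    case True
    then show ?thesis by (simp only:) (rule rank_less_empty[of "{#}"], simp)
  next
    case False
    then have ne: "T u \<noteq> {}" "Pi\<^sub>E U T \<noteq> {}" by (auto simp: PiE_eq_empty_iff)
    define le' where "le' = (\<lambda>p q. le ((snd p)(u := fst p)) ((snd q)(u := fst q)))"
    define c\<^sub>2 where "c\<^sub>2 = (\<lambda>f g. \<lambda>v\<in>U. c (f v) (g v))"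
    define le\<^sub>1 where "le\<^sub>1 = (\<lambda>s t. P ((restrict d (insert u U))(u := c s t)))"
    define le\<^sub>2 where "le\<^sub>2 = (\<lambda>f g. P ((c\<^sub>2 f g)(u := d u)))"
    have upd: "(\<lambda>v\<in>insert u U. c ((f(u := s)) v) ((g(u := t)) v)) = (c\<^sub>2 f g)(u := c s t)" for f g s t
      using insert.hyps(2) by (auto simp: c\<^sub>2_def)
    have P: "le' (s, f) (t, g) \<longleftrightarrow> P ((c\<^sub>2 f g)(u := c s t))"
      if "s \<in> T u" "t \<in> T u" "f \<in> Pi\<^sub>E U T" "g \<in> Pi\<^sub>E U T" for s t f g
      unfolding le'_def upd[symmetric] fst_conv snd_conv
      by (rule insert.prems(2)) (rule PiE_fun_upd; rule that)+
    have diag2: "c\<^sub>2 f f = restrict d U" if "f \<in> Pi\<^sub>E U T" for f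
      using that insert.prems(5) by (auto simp: c\<^sub>2_def restrict_def PiE_mem fun_eq_iff)
    have restr: "(restrict d U)(u := a) = (restrict d (insert u U))(u := a)" for a
      by (auto simp: restrict_def)
    have box: "box (T u) (Pi\<^sub>E U T) le' le\<^sub>1 le\<^sub>2 c c\<^sub>2 K (Pi\<^sub>E U (\<lambda>_. K)) (\<lambda>a h. P (h(u := a)))"
    proof (rule box.intro)
      show "lin_on (T u \<times> Pi\<^sub>E U T) le'"
      proof (rule lin_on_pullback[OF insert.prems(1), of "\<lambda>p. (snd p)(u := fst p)"])
        show "inj_on (\<lambda>p. (snd p)(u := fst p)) (T u \<times> Pi\<^sub>E U T)"
        proof (rule inj_onI)
          fix p q assume *: "p \<in> T u \<times> Pi\<^sub>E U T" "q \<in> T u \<times> Pi\<^sub>E U T"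
            "(snd p)(u := fst p) = (snd q)(u := fst q)"
          have "snd p u = undefined" "snd q u = undefined"
            using *(1,2) insert.hyps(2) PiE_arb[of _ U T u] unfolding mem_Times_iff by blast+
          then have "snd p v = snd q v" for v
            using fun_cong[OF *(3), of v] by (cases "v = u") simp_all
          moreover have "fst p = fst q" using fun_cong[OF *(3), of u] by simp
          ultimately show "p = q" by (auto simp: prod_eq_iff)
        qed
        show "(\<lambda>p. (snd p)(u := fst p)) ` (T u \<times> Pi\<^sub>E U T) \<subseteq> Pi\<^sub>E (insert u U) T"
          by (rule image_subsetI, rule PiE_fun_upd) (simp_all add: mem_Times_iff)
      qed (unfold le'_def, rule refl)
    next
      show "le' (x, y) (x', y) = le\<^sub>1 x x'" if "x \<in> T u" "x' \<in> T u" "y \<in> Pi\<^sub>E U T" for x x' y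
        using P[OF that(1,2,3,3)] by (simp add: le\<^sub>1_def diag2[OF that(3)] restr)
      show "le' (x, y) (x, y') = le\<^sub>2 y y'" if "x \<in> T u" "y \<in> Pi\<^sub>E U T" "y' \<in> Pi\<^sub>E U T" for x y y'
        using P[OF that(1,1,2,3)] by (simp add: le\<^sub>2_def insert.prems(5)[of u x] that)
      show "finite (U \<rightarrow>\<^sub>E K)" using insert by (simp add: finite_PiE)
      show "c\<^sub>2 f g \<in> U \<rightarrow>\<^sub>E K" if "f \<in> Pi\<^sub>E U T" "g \<in> Pi\<^sub>E U T" for f g
        using that insert.prems(4) unfolding c\<^sub>2_def by (simp add: PiE_iff) blast
    qed (use P insert.prems(3) insert.prems(4)[OF insertI1] in simp_all)
    have "rank_less le\<^sub>2 {#k#} (Pi\<^sub>E U T)"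
    proof (rule insert.IH[of _ "\<lambda>h. P (h(u := d u))"])
      show "lin_on (Pi\<^sub>E U T) le\<^sub>2" using box.lin\<^sub>2[OF box ne(1)] .
      fix v assume v: "v \<in> U"
      then have eq: "((restrict d U)(v := a))(u := d u) = (restrict d (insert u U))(v := a)" for a
        using insert.hyps(2) by (auto simp: restrict_def)
      show "rank_less (\<lambda>s t. P (((restrict d U)(v := c s t))(u := d u))) {#k#} (T v)"
        unfolding eq by (rule insert.prems(6)) (use v in simp)
    qed (unfold le\<^sub>2_def c\<^sub>2_def, rule refl, rule insert.prems(3),
        (erule insert.prems(4)[OF insertI2], assumption+), (erule insert.prems(5)[OF insertI2], assumption))
    moreover have "rank_less le\<^sub>1 {#k#} (T u)" unfolding le\<^sub>1_def by (rule insert.prems(6)) simp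
    ultimately obtain \<alpha> \<beta> where "\<alpha> < {#k#}" "\<beta> < {#k#}" "rank_le le\<^sub>1 \<alpha> (T u)" "rank_le le\<^sub>2 \<beta> (Pi\<^sub>E U T)"
      unfolding rank_less_def by blast
    then have "rank_le le' (\<alpha> + \<beta>) (T u \<times> Pi\<^sub>E U T)" "\<alpha> + \<beta> < {#k#}"
      using rank_le_box[OF box] by auto
    then have "rank_less le' {#k#} (T u \<times> Pi\<^sub>E U T)" unfolding rank_less_def by blast
    then show ?thesis
    \<comment> \<open>Extensional functions are \<open>undefined\<close> outside their domain, so
      this update restricts \<open>h\<close> to \<open>U\<close>.\<close>
    proof (rule rank_less_embed[where f = "\<lambda>h. (h u, h(u := undefined))"])
      show "inj_on (\<lambda>h. (h u, h(u := undefined))) (Pi\<^sub>E (insert u U) T)"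
      proof (rule inj_onI)
        fix h h' assume "(h u, h(u := undefined)) = (h' u, h'(u := undefined))"
        then show "h = h'" by (metis fun_upd_triv fun_upd_upd prod.inject)
      qed
      show "(\<lambda>h. (h u, h(u := undefined))) ` Pi\<^sub>E (insert u U) T \<subseteq> T u \<times> Pi\<^sub>E U T"
        using fun_upd_in_PiE[OF insert.hyps(2)] by (auto dest: PiE_mem)
    qed (simp add: le'_def)
  qed
qed

section \<open>Finite condensation\<close>

lemma is_succ_of_unique: "is_succ_of \<alpha> \<beta> \<Longrightarrow> is_succ_of \<alpha> \<gamma> \<Longrightarrow> \<beta> = \<gamma>"
  unfolding is_succ_of_def by (meson linorder_cases)

text \<open>The index type may have a greatest element; a successor of \<open>\<beta>\<close> is
  obtained from any element above it.\<close>

lemma is_succ_of_Least: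
  assumes "\<beta> < \<alpha>" shows "is_succ_of (LEAST \<gamma>. \<beta> < \<gamma>) \<beta>" "(LEAST \<gamma>. \<beta> < \<gamma>) \<le> \<alpha>"
  using assms unfolding is_succ_of_def by (auto intro: LeastI Least_le dest: not_less_Least)

lemma fc_cond_rec:
  "fc_cond A r \<alpha> = (if \<forall>\<beta>. \<not> \<beta> < \<alpha> then Id_on A
     else if \<exists>\<beta>. is_succ_of \<alpha> \<beta> then fc_step A r (fc_cond A r (THE \<beta>. is_succ_of \<alpha> \<beta>))
     else (\<Union>\<beta>\<in>{\<beta>. \<beta> < \<alpha>}. fc_cond A r \<beta>))"
proof -
  \<comment> \<open>The recursive call goes to a smaller index, so the cut in the unfolding of
    \<open>wfrec\<close> has no effect there.\<close>
  have "(THE \<beta>. is_succ_of \<alpha> \<beta>) < \<alpha>" if "\<exists>\<beta>. is_succ_of \<alpha> \<beta>"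
    using theI'[of "is_succ_of \<alpha>"] that is_succ_of_unique[of \<alpha>] unfolding is_succ_of_def by blast
  then show ?thesis
    by (subst fc_cond_def, subst wfrec[OF wf]) (auto simp: fc_cond_def[symmetric] cut_apply)
qed

lemma fc_cond_least: "(\<And>\<beta>. \<not> \<beta> < \<alpha>) \<Longrightarrow> fc_cond A r \<alpha> = Id_on A"
  by (subst fc_cond_rec) simp

lemma fc_cond_succ: "is_succ_of \<alpha> \<beta> \<Longrightarrow> fc_cond A r \<alpha> = fc_step A r (fc_cond A r \<beta>)"
proof -
  assume *: "is_succ_of \<alpha> \<beta>"
  then have "(THE \<beta>. is_succ_of \<alpha> \<beta>) = \<beta>" by (blast intro: is_succ_of_unique)
  moreover have "\<not> (\<forall>\<beta>. \<not> \<beta> < \<alpha>)" using * unfolding is_succ_of_def by blast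
  moreover have "\<exists>\<beta>. is_succ_of \<alpha> \<beta>" using * by blast
  ultimately show ?thesis by (simp only: fc_cond_rec[of A r \<alpha>] if_False if_True)
qed

lemma fc_cond_limit:
  "\<delta> < \<alpha> \<Longrightarrow> \<nexists>\<beta>. is_succ_of \<alpha> \<beta> \<Longrightarrow> fc_cond A r \<alpha> = (\<Union>\<beta>\<in>{\<beta>. \<beta> < \<alpha>}. fc_cond A r \<beta>)"
  unfolding fc_cond_rec[of A r \<alpha>] by metis

section \<open>Equivalence relations with convex classes\<close>

text \<open>Convexity is stated at the left end point only; \<open>(z, y) \<in> R\<close> then
  follows by symmetry and transitivity.\<close>

definition condensation :: "'a set \<Rightarrow> 'a rel \<Rightarrow> 'a rel \<Rightarrow> bool" where
  "condensation A r R \<longleftrightarrow> equiv A R \<and>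
     (\<forall>x\<in>A. \<forall>y\<in>A. \<forall>z\<in>A. (x, y) \<in> R \<longrightarrow> (x, z) \<in> r \<longrightarrow> (z, y) \<in> r \<longrightarrow> (x, z) \<in> R)"

definition between :: "'a set \<Rightarrow> 'a rel \<Rightarrow> 'a \<Rightarrow> 'a \<Rightarrow> 'a set" where
  "between A r x y = {z\<in>A. (x, z) \<in> r \<and> (z, y) \<in> r}"

lemma fc_step_iff:
  "(x, y) \<in> fc_step A r R \<longleftrightarrow> x \<in> A \<and> y \<in> A \<and>
     finite ((\<lambda>z. R `` {z}) ` between A r x y) \<and> finite ((\<lambda>z. R `` {z}) ` between A r y x)"
proof -
  have "{R `` {z} | z. z \<in> A \<and> (((x, z) \<in> r \<and> (z, y) \<in> r) \<or> ((y, z) \<in> r \<and> (z, x) \<in> r))} =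
      (\<lambda>z. R `` {z}) ` between A r x y \<union> (\<lambda>z. R `` {z}) ` between A r y x"
    unfolding between_def by auto
  then show ?thesis unfolding fc_step_def by simp
qed

lemma fc_step_sym: "(x, y) \<in> fc_step A r R \<Longrightarrow> (y, x) \<in> fc_step A r R"
  unfolding fc_step_iff by blast

lemma finite_image_factor:
  assumes "finite (\<sigma> ` Z)" "\<And>z z'. z \<in> Z \<Longrightarrow> z' \<in> Z \<Longrightarrow> \<sigma> z = \<sigma> z' \<Longrightarrow> g z = g z'"
  shows "finite (g ` Z)"
proof (rule finite_subset)
  show "g ` Z \<subseteq> (\<lambda>s. g (inv_into Z \<sigma> s)) ` \<sigma> ` Z"
  proof (rule image_subsetI)
    fix z assume z: "z \<in> Z"
    have "g z = g (inv_into Z \<sigma> (\<sigma> z))"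
      by (rule assms(2)) (use z in \<open>auto simp: inv_into_into f_inv_into_f\<close>)
    then show "g z \<in> (\<lambda>s. g (inv_into Z \<sigma> s)) ` \<sigma> ` Z" using z by blast
  qed
qed (use assms(1) in simp)

context
  fixes A :: "'a set" and r :: "'a rel"
  assumes lin_on: "lin_on A (\<lambda>x y. (x, y) \<in> r)"
begin

lemma between_subset_singleton: "x \<in> A \<Longrightarrow> y \<in> A \<Longrightarrow> (x, y) \<in> r \<Longrightarrow> between A r y x \<subseteq> {x}"
  unfolding between_def using lin_on_antisym[OF lin_on] lin_on_trans[OF lin_on] by blast

lemma fc_step_iff_le:
  assumes "x \<in> A" "y \<in> A" "(x, y) \<in> r"
  shows "(x, y) \<in> fc_step A r R \<longleftrightarrow> finite ((\<lambda>z. R `` {z}) ` between A r x y)"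
  unfolding fc_step_iff using assms finite_subset[OF between_subset_singleton[OF assms]] by simp

lemma between_Un: "\<lbrakk>x \<in> A; y \<in> A; z \<in> A\<rbrakk> \<Longrightarrow> between A r x z \<subseteq> between A r x y \<union> between A r y z"
  unfolding between_def using lin_on_linear[OF lin_on] by blast

text \<open>An interval with end points in one class meets no other class, whence the inclusion.
  Transitivity holds because two intervals with a common end point cover the interval between the
  outer end points, whatever the relative order of the three points.\<close>

lemma condensation_fc_step:
  assumes R: "condensation A r R"
  shows "condensation A r (fc_step A r R)" and "R \<subseteq> fc_step A r R"
proof -
  have eq: "equiv A R" and conv: "\<And>x y z. \<lbrakk>x \<in> A; y \<in> A; z \<in> A; (x, y) \<in> R; (x, z) \<in> r; (z, y) \<in> r\<rbrakk> \<Longrightarrow> (x, z) \<in> R"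
    using R unfolding condensation_def by blast+
  have sub: "R \<subseteq> A \<times> A" using eq by (rule equiv_type)
  show "R \<subseteq> fc_step A r R"
  proof (rule subrelI)
    fix x y assume xy: "(x, y) \<in> R"
    have one: "(\<lambda>z. R `` {z}) ` between A r u v \<subseteq> {R `` {u}}" if "(u, v) \<in> R" for u v
      using that conv[of u v] sub equiv_class_eq[OF eq] unfolding between_def by blast
    have "(y, x) \<in> R" using xy eq by (meson equivE symE)
    then show "(x, y) \<in> fc_step A r R" unfolding fc_step_iff
      using finite_subset[OF one] xy sub by auto
  qed
  have "refl_on A (fc_step A r R)"
  proof (rule refl_onI)
    fix x assume x: "x \<in> A"
    then have "(x, x) \<in> R" using eq by (meson equivE refl_onD)
    then show "(x, x) \<in> fc_step A r R" using \<open>R \<subseteq> fc_step A r R\<close> by blast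
  qed
  moreover have "sym (fc_step A r R)" by (rule symI) (rule fc_step_sym)
  moreover have "Relation.trans (fc_step A r R)"
  proof (rule transI)
    fix x y z assume *: "(x, y) \<in> fc_step A r R" "(y, z) \<in> fc_step A r R"
    then have "x \<in> A" "y \<in> A" "z \<in> A" unfolding fc_step_iff by auto
    note Un = image_mono[OF between_Un[OF this], of "\<lambda>z. R `` {z}", unfolded image_Un]
      image_mono[OF between_Un[OF this(3,2,1)], of "\<lambda>z. R `` {z}", unfolded image_Un]
    show "(x, z) \<in> fc_step A r R" unfolding fc_step_iff
      using * finite_subset[OF Un(1)] finite_subset[OF Un(2)] unfolding fc_step_iff by simp
  qed
  moreover have "fc_step A r R \<subseteq> A \<times> A" unfolding fc_step_def by blast
  ultimately have "equiv A (fc_step A r R)" by (intro equivI)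
  moreover have "(x, z) \<in> fc_step A r R"
    if "x \<in> A" "y \<in> A" "z \<in> A" "(x, y) \<in> fc_step A r R" "(x, z) \<in> r" "(z, y) \<in> r" for x y z
  proof -
    have "(x, y) \<in> r" using that lin_on_trans[OF lin_on] by blast
    then have "finite ((\<lambda>z. R `` {z}) ` between A r x y)" using fc_step_iff_le that by blast
    moreover have "between A r x z \<subseteq> between A r x y"
      unfolding between_def using that lin_on_trans[OF lin_on] by blast
    ultimately show ?thesis using fc_step_iff_le that by (meson finite_subset image_mono)
  qed
  ultimately show "condensation A r (fc_step A r R)" unfolding condensation_def by blast
qed

text \<open>One induction for both claims: monotonicity at a successor needs the condensation below
  it, and transitivity at a limit moves two pairs to the larger of their stages by
  monotonicity.\<close>

lemma condensation_mono_fc_cond: "condensation A r (fc_cond A r \<alpha>) \<and> (\<forall>\<beta>\<le>\<alpha>. fc_cond A r \<beta> \<subseteq> fc_cond A r \<alpha>)"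
proof (induction \<alpha> rule: less_induct)
  case (less \<alpha>)
  consider "\<And>\<beta>. \<not> \<beta> < \<alpha>" | \<delta> where "is_succ_of \<alpha> \<delta>" | \<delta> where "\<delta> < \<alpha>" "\<nexists>\<beta>. is_succ_of \<alpha> \<beta>" by blast
  then show ?case
  proof cases
    case 1
    then have "\<beta> = \<alpha>" if "\<beta> \<le> \<alpha>" for \<beta> using that by (auto simp: order.order_iff_strict)
    moreover have "condensation A r (Id_on A)" unfolding condensation_def
      using lin_on_antisym[OF lin_on]
      by (auto intro!: equivI refl_onI symI transI)
    ultimately show ?thesis by (metis fc_cond_least[OF 1] subset_refl)
  next
    case 2
    then have \<delta>: "\<delta> < \<alpha>" "\<And>\<beta>. \<beta> < \<alpha> \<Longrightarrow> \<beta> \<le> \<delta>" unfolding is_succ_of_def by (auto simp: not_less)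
    note IH = less.IH[OF \<delta>(1)]
    have "fc_cond A r \<beta> \<subseteq> fc_cond A r \<alpha>" if "\<beta> \<le> \<alpha>" for \<beta>
    proof (cases "\<beta> = \<alpha>")
      case False
      then have "fc_cond A r \<beta> \<subseteq> fc_cond A r \<delta>" using IH \<delta>(2) that by simp
      also have "\<dots> \<subseteq> fc_cond A r \<alpha>"
        unfolding fc_cond_succ[OF 2] using IH condensation_fc_step(2) by blast
      finally show ?thesis .
    qed simp
    then show ?thesis using IH condensation_fc_step(1) unfolding fc_cond_succ[OF 2] by blast
  next
    case 3
    note lim = fc_cond_limit[OF 3, of A r]
    have mono: "fc_cond A r \<beta> \<subseteq> fc_cond A r \<alpha>" if "\<beta> \<le> \<alpha>" for \<beta>
      using that lim by (cases "\<beta> = \<alpha>") auto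
    have IH: "condensation A r (fc_cond A r \<beta>)" "\<And>\<gamma>. \<gamma> \<le> \<beta> \<Longrightarrow> fc_cond A r \<gamma> \<subseteq> fc_cond A r \<beta>"
      if "\<beta> < \<alpha>" for \<beta> using less.IH[OF that] by auto
    have eq: "equiv A (fc_cond A r \<beta>)" if "\<beta> < \<alpha>" for \<beta>
      using IH(1)[OF that] unfolding condensation_def by blast
    have "equiv A (fc_cond A r \<alpha>)"
    proof (rule equivI)
      show "fc_cond A r \<alpha> \<subseteq> A \<times> A" unfolding lim using equiv_type[OF eq] by blast
      show "refl_on A (fc_cond A r \<alpha>)"
      proof (rule refl_onI)
        fix x assume "x \<in> A"
        then have "(x, x) \<in> fc_cond A r \<delta>" using eq[OF 3(1)] by (meson equivE refl_onD)
        then show "(x, x) \<in> fc_cond A r \<alpha>" using lim 3 by blast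
      qed
      show "sym (fc_cond A r \<alpha>)"
      proof (rule symI)
        fix x y assume "(x, y) \<in> fc_cond A r \<alpha>"
        then obtain \<beta> where \<beta>: "\<beta> < \<alpha>" "(x, y) \<in> fc_cond A r \<beta>" unfolding lim by blast
        then have "(y, x) \<in> fc_cond A r \<beta>" using eq by (meson equivE symE)
        then show "(y, x) \<in> fc_cond A r \<alpha>" using lim \<beta> by blast
      qed
      show "Relation.trans (fc_cond A r \<alpha>)"
      proof (rule transI)
        fix x y z assume "(x, y) \<in> fc_cond A r \<alpha>" "(y, z) \<in> fc_cond A r \<alpha>"
        then obtain \<beta> \<gamma> where \<beta>\<gamma>: "\<beta> < \<alpha>" "\<gamma> < \<alpha>" "(x, y) \<in> fc_cond A r \<beta>" "(y, z) \<in> fc_cond A r \<gamma>"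
          unfolding lim by blast
        then have m: "max \<beta> \<gamma> < \<alpha>" by simp
        have "(x, y) \<in> fc_cond A r (max \<beta> \<gamma>)" "(y, z) \<in> fc_cond A r (max \<beta> \<gamma>)"
          using IH(2)[OF m, of \<beta>] IH(2)[OF m, of \<gamma>] \<beta>\<gamma> by auto
        then have "(x, z) \<in> fc_cond A r (max \<beta> \<gamma>)" using eq[OF m] by (meson equivE transE)
        then show "(x, z) \<in> fc_cond A r \<alpha>" using lim m by blast
      qed
    qed
    moreover have "(x, z) \<in> fc_cond A r \<alpha>"
      if xyz: "x \<in> A" "y \<in> A" "z \<in> A" "(x, y) \<in> fc_cond A r \<alpha>" "(x, z) \<in> r" "(z, y) \<in> r" for x y z
    proof -
      obtain \<beta> where "\<beta> < \<alpha>" "(x, y) \<in> fc_cond A r \<beta>" using xyz(4) unfolding lim by blast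
      then show ?thesis using xyz IH(1)[of \<beta>] lim unfolding condensation_def by blast
    qed
    ultimately show ?thesis using mono unfolding condensation_def by blast
  qed
qed

lemmas condensation_fc_cond = condensation_mono_fc_cond[THEN conjunct1]

lemma fc_cond_mono: "\<beta> \<le> \<alpha> \<Longrightarrow> fc_cond A r \<beta> \<subseteq> fc_cond A r \<alpha>"
  using condensation_mono_fc_cond by blast

lemma equiv_fc_cond: "equiv A (fc_cond A r \<alpha>)"
  using condensation_fc_cond unfolding condensation_def by blast

lemma fc_stable_fromI:
  fixes \<alpha> :: "'o::wellorder"
  assumes step: "fc_step A r (fc_cond A r \<alpha>) \<subseteq> fc_cond A r \<alpha>"
  shows "fc_stable_from A r \<alpha>"
proof -
  have "fc_cond A r \<beta> \<subseteq> fc_cond A r \<alpha>" for \<beta> :: 'o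
  proof (induction \<beta> rule: less_induct)
    case (less \<beta>)
    consider "\<beta> \<le> \<alpha>" | \<delta> where "\<alpha> < \<beta>" "is_succ_of \<beta> \<delta>" | "\<alpha> < \<beta>" "\<nexists>\<delta>. is_succ_of \<beta> \<delta>"
      by (meson not_less)
    then show ?case
    proof cases
      case 1
      then show ?thesis by (rule fc_cond_mono)
    next
      case 2
      then have "\<alpha> \<le> \<delta>" "\<delta> < \<beta>" unfolding is_succ_of_def by (auto simp: not_less)
      then have "fc_cond A r \<delta> = fc_cond A r \<alpha>" using less.IH fc_cond_mono by blast
      then show ?thesis using fc_cond_succ[OF 2(2), of A r] step by simp
    next
      case 3
      then show ?thesis unfolding fc_cond_limit[OF 3] using less.IH by blast
    qed
  qed
  then show ?thesis unfolding fc_stable_from_def using fc_cond_mono by blast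
qed

section \<open>Ranks of intervals versus stages of condensation\<close>

text \<open>At a successor, the finitely many classes of the preceding stage that meet the interval
  form the cover: by induction, points in one class span an interval bounded by the preceding index.
  At a limit, the pair already belongs to an earlier stage.\<close>

lemma rank_le_between:
  assumes "(x, y) \<in> fc_cond A r \<alpha>" "(x, y) \<in> r"
  shows "rank_le (\<lambda>x y. (x, y) \<in> r) \<alpha> (between A r x y)"
  using assms
proof (induction \<alpha> arbitrary: x y rule: less_induct)
  case (less \<alpha>)
  have xy: "x \<in> A" "y \<in> A" using less.prems(1) equiv_type[OF equiv_fc_cond] by blast+
  consider "\<And>\<beta>. \<not> \<beta> < \<alpha>" | \<delta> where "is_succ_of \<alpha> \<delta>" | \<delta> where "\<delta> < \<alpha>" "\<nexists>\<beta>. is_succ_of \<alpha> \<beta>" by blast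
  then show ?case
  proof cases
    case 1
    have "x = y" using less.prems(1) unfolding fc_cond_least[OF 1] by blast
    then show ?thesis using between_subset_singleton[OF xy less.prems(2)]
      by (auto intro: rank_le_subset[OF rank_le_singleton])
  next
    case 2
    then have \<delta>: "\<delta> < \<alpha>" unfolding is_succ_of_def by blast
    let ?R = "fc_cond A r \<delta>" and ?I = "between A r x y"
    have fin: "finite ((\<lambda>z. ?R `` {z}) ` ?I)"
      using less.prems fc_step_iff_le[OF xy less.prems(2)] fc_cond_succ[OF 2] by blast
    have "rank_le (\<lambda>x y. (x, y) \<in> r) \<alpha> (\<Union>((\<lambda>z. ?R `` {z} \<inter> ?I) ` ?I))"
    proof (rule rank_le_Union)
      have "(\<lambda>z. ?R `` {z} \<inter> ?I) ` ?I = (\<lambda>C. C \<inter> ?I) ` (\<lambda>z. ?R `` {z}) ` ?I"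
        by (simp add: image_image)
      then show "finite ((\<lambda>z. ?R `` {z} \<inter> ?I) ` ?I)" using fin by simp
    next
      fix B assume "B \<in> (\<lambda>z. ?R `` {z} \<inter> ?I) ` ?I"
      then obtain w where B: "B = ?R `` {w} \<inter> ?I" by blast
      show "rank_le (\<lambda>x y. (x, y) \<in> r) \<alpha> B"
      proof (rule locally_less_imp_rank_le, unfold locally_less_def, intro ballI impI)
        fix u v assume uv: "u \<in> B" "v \<in> B" "(u, v) \<in> r"
        then have "(u, v) \<in> ?R" using B equiv_fc_cond[of \<delta>] by (meson IntD1 Image_singleton_iff equivE symE transE)
        then have "rank_le (\<lambda>x y. (x, y) \<in> r) \<delta> (between A r u v)" using less.IH \<delta> uv by blast
        then have "rank_less (\<lambda>x y. (x, y) \<in> r) \<alpha> (between A r u v)" unfolding rank_less_def using \<delta> by blast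
        then show "rank_less (\<lambda>x y. (x, y) \<in> r) \<alpha> {z \<in> B. (u, z) \<in> r \<and> (z, v) \<in> r}"
          by (rule rank_less_subset) (auto simp: B between_def)
      qed
    qed
    then show ?thesis
    proof (rule rank_le_subset, intro subsetI)
      fix z assume z: "z \<in> ?I"
      then have "(z, z) \<in> ?R" using equiv_fc_cond[of \<delta>] unfolding between_def
        by (metis (no_types, lifting) equivE mem_Collect_eq refl_onD)
      then show "z \<in> \<Union>((\<lambda>z. ?R `` {z} \<inter> ?I) ` ?I)" using z by blast
    qed
  next
    case 3
    then obtain \<beta> where "\<beta> < \<alpha>" "(x, y) \<in> fc_cond A r \<beta>"
      using less.prems unfolding fc_cond_limit[OF 3] by blast
    then show ?thesis using less.IH[OF _ _ less.prems(2)] by (meson less_imp_le rank_le_mono)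
  qed
qed

lemma fc_condI:
  assumes "\<beta> < \<alpha>" "x \<in> A" "y \<in> A" "(x, y) \<in> r" "finite ((\<lambda>z. fc_cond A r \<beta> `` {z}) ` between A r x y)"
  shows "(x, y) \<in> fc_cond A r \<alpha>"
proof -
  have "(x, y) \<in> fc_step A r (fc_cond A r \<beta>)" using fc_step_iff_le assms by blast
  then show ?thesis using fc_cond_succ is_succ_of_Least[OF assms(1)] fc_cond_mono by blast
qed

text \<open>The pieces of a cover witnessing the rank need not be convex; cutting at the ends of
  their convex hulls leaves finitely many intervals, each contained in a single class.\<close>

lemma finite_classes_if_rank_le:
  assumes "rank_le (\<lambda>x y. (x, y) \<in> r) \<alpha> Z" "Z \<subseteq> A"
    and "\<And>x y. x \<in> Z \<Longrightarrow> y \<in> Z \<Longrightarrow> between A r x y \<subseteq> Z"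
  shows "finite ((\<lambda>z. fc_cond A r \<alpha> `` {z}) ` Z)"
  using assms
proof (induction \<alpha> arbitrary: Z rule: less_induct)
  case (less \<alpha>)
  let ?le = "\<lambda>x y. (x, y) \<in> r"
  obtain F where F: "finite F" "Z = \<Union>F" "\<And>B. B \<in> F \<Longrightarrow> locally_less ?le \<alpha> B"
    using less.prems(1) unfolding rank_le_iff by blast
  \<comment> \<open>\<open>\<sigma> z\<close> records the pieces with an element at or below
    \<open>z\<close> and those with an element at or above \<open>z\<close>. If two points agree,
    each piece that meets the interval between them reaches beyond both of its ends.\<close>
  define \<sigma> where "\<sigma> z = ({B\<in>F. \<exists>b\<in>B. (b, z) \<in> r}, {B\<in>F. \<exists>b\<in>B. (z, b) \<in> r})" for z
  have same: "(z, z') \<in> fc_cond A r \<alpha>"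
    if z: "z \<in> Z" "z' \<in> Z" "z \<noteq> z'" "(z, z') \<in> r" "\<sigma> z = \<sigma> z'" for z z'
  proof -
    let ?I = "between A r z z'"
    have zA: "z \<in> A" "z' \<in> A" using z less.prems(2) by auto
    have piece: "rank_less ?le \<alpha> (B \<inter> ?I)" if B: "B \<in> F" "B \<inter> ?I \<noteq> {}" for B
    proof -
      have BA: "B \<subseteq> A" using B F less.prems(2) by blast
      obtain b where b: "b \<in> B" "(z, b) \<in> r" "(b, z') \<in> r" using B unfolding between_def by blast
      then have "B \<in> fst (\<sigma> z')" "B \<in> snd (\<sigma> z)" using B unfolding \<sigma>_def by auto
      then have "B \<in> fst (\<sigma> z)" "B \<in> snd (\<sigma> z')" using z(5) by simp_all
      then obtain b1 b2 where b12: "b1 \<in> B" "(b1, z) \<in> r" "b2 \<in> B" "(z', b2) \<in> r"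
        unfolding \<sigma>_def by auto
      then have "b1 \<in> A" "b2 \<in> A" using BA by auto
      note tr = lin_on_trans[OF lin_on]
      have le1: "(b1, z') \<in> r" by (rule tr[of b1 z z']) (use b12 z zA \<open>b1 \<in> A\<close> in auto)
      have le2: "(b1, b2) \<in> r" by (rule tr[of b1 z' b2]) (use le1 b12 zA \<open>b1 \<in> A\<close> \<open>b2 \<in> A\<close> in auto)
      \<comment> \<open>\<open>locally_less\<close> speaks of distinct end points only; equality
        would squeeze \<open>z\<close> and \<open>z'\<close> together.\<close>
      have "b1 \<noteq> b2"
      proof
        assume "b1 = b2"
        then have "z' = b1" using lin_on_antisym[OF lin_on] le1 b12 zA \<open>b1 \<in> A\<close> by blast
        then show False using lin_on_antisym[OF lin_on] z b12 zA by blast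
      qed
      then have "rank_less ?le \<alpha> {u\<in>B. (b1, u) \<in> r \<and> (u, b2) \<in> r}"
        using F(3)[OF B(1)] b12 le2 unfolding locally_less_def by blast
      moreover have "B \<inter> ?I \<subseteq> {u\<in>B. (b1, u) \<in> r \<and> (u, b2) \<in> r}"
      proof
        fix u assume u: "u \<in> B \<inter> ?I"
        have "(b1, u) \<in> r" by (rule tr[of b1 z u]) (use u b12 zA \<open>b1 \<in> A\<close> in \<open>auto simp: between_def\<close>)
        moreover have "(u, b2) \<in> r"
          by (rule tr[of u z' b2]) (use u b12 zA \<open>b2 \<in> A\<close> in \<open>auto simp: between_def\<close>)
        ultimately show "u \<in> {u\<in>B. (b1, u) \<in> r \<and> (u, b2) \<in> r}" using u by blast
      qed
      ultimately show ?thesis by (rule rank_less_subset)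
    qed
    have zI: "z \<in> ?I" using zA z lin_on_refl[OF lin_on] unfolding between_def by blast
    moreover obtain B where "B \<in> F" "z \<in> B" using z F by blast
    ultimately have "rank_less ?le \<alpha> (B \<inter> ?I)" using piece by blast
    \<comment> \<open>Some index below \<open>\<alpha>\<close> is needed for the empty pieces of the
      union.\<close>
    then obtain \<delta> where \<delta>: "\<delta> < \<alpha>" unfolding rank_less_def by blast
    have "rank_less ?le \<alpha> (\<Union>((\<lambda>B. B \<inter> ?I) ` F))"
    proof (rule rank_less_Union[OF _ _ \<delta>])
      fix C assume "C \<in> (\<lambda>B. B \<inter> ?I) ` F"
      then show "rank_less ?le \<alpha> C" using piece rank_less_empty[OF \<delta>] by (cases "C = {}") auto
    qed (use F in simp)
    moreover have "?I \<subseteq> \<Union>((\<lambda>B. B \<inter> ?I) ` F)" using less.prems(3)[OF z(1,2)] F(2) by blast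
    ultimately have "rank_less ?le \<alpha> ?I" by (rule rank_less_subset)
    then obtain \<beta> where \<beta>: "\<beta> < \<alpha>" "rank_le ?le \<beta> ?I" unfolding rank_less_def by blast
    have "finite ((\<lambda>z. fc_cond A r \<beta> `` {z}) ` ?I)"
    proof (rule less.IH[OF \<beta>])
      fix x y assume xy: "x \<in> ?I" "y \<in> ?I"
      note tr = lin_on_trans[OF lin_on]
      show "between A r x y \<subseteq> ?I"
      proof
        fix u assume u: "u \<in> between A r x y"
        have "(z, u) \<in> r" by (rule tr[of z x u]) (use u xy zA in \<open>auto simp: between_def\<close>)
        moreover have "(u, z') \<in> r" by (rule tr[of u y z']) (use u xy zA in \<open>auto simp: between_def\<close>)
        ultimately show "u \<in> ?I" using u by (simp add: between_def)
      qed
    qed (auto simp: between_def)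
    then show ?thesis using fc_condI[OF \<beta>(1) zA z(4)] by blast
  qed
  show ?case
  proof (rule finite_image_factor)
    have "\<sigma> ` Z \<subseteq> Pow F \<times> Pow F" unfolding \<sigma>_def by auto
    then show "finite (\<sigma> ` Z)" by (rule finite_subset) (simp add: F(1))
  next
    fix z z' assume z: "z \<in> Z" "z' \<in> Z" "\<sigma> z = \<sigma> z'"
    have "z = z' \<or> (z, z') \<in> fc_cond A r \<alpha> \<or> (z', z) \<in> fc_cond A r \<alpha>"
      using same[of z z'] same[of z' z] z less.prems(2) lin_on_linear[OF lin_on, of z z'] by auto
    then show "fc_cond A r \<alpha> `` {z} = fc_cond A r \<alpha> `` {z'}"
      using equiv_class_eq[OF equiv_fc_cond[of \<alpha>]] by metis
  qed
qed

text \<open>A bound \<open>\<beta>\<close> strictly below \<open>\<alpha>\<close> leaves finitely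
  many classes at stage \<open>\<beta>\<close>. One further step merges them, and the successor of
  \<open>\<beta>\<close> is at most \<open>\<alpha>\<close>.\<close>

lemma fc_cond_if_rank_less:
  assumes "rank_less (\<lambda>x y. (x, y) \<in> r) \<alpha> (between A r x y)" "x \<in> A" "y \<in> A" "(x, y) \<in> r"
  shows "(x, y) \<in> fc_cond A r \<alpha>"
proof -
  obtain \<beta> where \<beta>: "\<beta> < \<alpha>" "rank_le (\<lambda>x y. (x, y) \<in> r) \<beta> (between A r x y)"
    using assms(1) unfolding rank_less_def by blast
  have "finite ((\<lambda>z. fc_cond A r \<beta> `` {z}) ` between A r x y)"
  proof (rule finite_classes_if_rank_le[OF \<beta>(2)])
    fix u v assume uv: "u \<in> between A r x y" "v \<in> between A r x y"
    note tr = lin_on_trans[OF lin_on]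
    show "between A r u v \<subseteq> between A r x y"
    proof
      fix w assume w: "w \<in> between A r u v"
      have "(x, w) \<in> r" by (rule tr[of x u w]) (use uv w assms in \<open>auto simp: between_def\<close>)
      moreover have "(w, y) \<in> r" by (rule tr[of w v y]) (use uv w assms in \<open>auto simp: between_def\<close>)
      ultimately show "w \<in> between A r x y" using w by (simp add: between_def)
    qed
  qed (auto simp: between_def)
  then show ?thesis using fc_condI[OF \<beta>(1)] assms by blast
qed

end

section \<open>Tree automata\<close>

definition subtree :: "'s tree \<Rightarrow> bool list \<Rightarrow> 's tree" where
  "subtree t u = (\<lambda>w. t (u @ w))"

lemma subtree_Nil [simp]: "subtree t [] = t"
  by (simp add: subtree_def)

lemma subtree_subtree: "subtree (subtree t u) v = subtree t (u @ v)"
  by (simp add: subtree_def)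

lemma finite_dom_subtree: "finite (dom t) \<Longrightarrow> finite (dom (subtree t u))"
proof -
  assume "finite (dom t)"
  moreover have "dom (subtree t u) = (@) u -` dom t" by (auto simp: subtree_def)
  ultimately show ?thesis by (simp add: finite_vimageI inj_on_def)
qed

lemma is_tree_subtree: "is_tree \<Sigma> t \<Longrightarrow> is_tree \<Sigma> (subtree t u)"
proof -
  assume t: "is_tree \<Sigma> t"
  have "ran (subtree t u) \<subseteq> ran t" by (auto simp: subtree_def ran_def)
  moreover have "v \<in> dom (subtree t u)" if "v @ w \<in> dom (subtree t u)" for v w
  proof -
    have "(u @ v) @ w \<in> dom t" using that by (simp add: subtree_def dom_def)
    then have "u @ v \<in> dom t" using t unfolding is_tree_def by blast
    then show ?thesis by (simp add: subtree_def dom_def)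
  qed
  ultimately show ?thesis using t finite_dom_subtree unfolding is_tree_def by blast
qed

lemma depth_bound: "finite (S :: 'b list set) \<Longrightarrow> \<exists>n. \<forall>u\<in>S. length u < n"
  by (meson finite_imageI finite_nat_set_iff_bounded imageI)

lemma is_run_subtree: "is_run M t \<rho> \<Longrightarrow> is_run M (subtree t u) (\<lambda>w. \<rho> (u @ w))"
  unfolding is_run_def subtree_def by (metis append.assoc)

lemma ex_run:
  assumes "finite (dom t)" shows "\<exists>\<rho>. is_run M t \<rho>"
proof -
  have "\<exists>\<rho>. is_run M t \<rho>" if "\<forall>u\<in>dom t. length u < n" for n
    using that
  proof (induction n arbitrary: t)
    case 0
    then have "t u = None" for u by (auto simp: dom_def)
    then show ?case unfolding is_run_def by (intro exI[of _ "\<lambda>_. init M"]) simp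
  next
    case (Suc n)
    have "\<exists>\<rho>. is_run M (subtree t [b]) \<rho>" for b
      by (rule Suc.IH) (use Suc.prems in \<open>auto simp: subtree_def dom_def\<close>)
    then obtain R where R: "\<And>b. is_run M (subtree t [b]) (R b)" by metis
    define \<rho> where "\<rho> u = (case u of [] \<Rightarrow> (case t [] of None \<Rightarrow> init M
        | Some a \<Rightarrow> trans M (R False []) a (R True [])) | b # w \<Rightarrow> R b w)" for u
    have "\<rho> u = (case t u of None \<Rightarrow> init M
        | Some a \<Rightarrow> trans M (\<rho> (u @ [False])) a (\<rho> (u @ [True])))" for u
    proof (cases u)
      case Nil
      then show ?thesis by (simp add: \<rho>_def split: option.split)
    next
      case (Cons b w)
      then show ?thesis using R[of b] unfolding is_run_def by (simp add: \<rho>_def subtree_def split: option.split)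
    qed
    then show ?case unfolding is_run_def by blast
  qed
  then show ?thesis using depth_bound[OF assms] by blast
qed

text \<open>Induction from deep positions towards the root: outside the domain the state is the
  initial one.\<close>

lemma run_unique:
  assumes "finite (dom t)" "is_run M t \<rho>" "is_run M t \<rho>'"
  shows "\<rho> u = \<rho>' u"
proof -
  obtain n where n: "\<forall>u\<in>dom t. length u < n" using depth_bound[OF assms(1)] by blast
  show ?thesis
  proof (induction "n - length u" arbitrary: u rule: less_induct)
    case less
    show ?case
    proof (cases "t u")
      case None
      then show ?thesis using assms(2,3) unfolding is_run_def by simp
    next
      case (Some a)
      then have "length u < n" using n by blast
      then have "\<rho> (u @ [b]) = \<rho>' (u @ [b])" for b by (intro less) simp
      then show ?thesis using assms(2,3) Some unfolding is_run_def by simp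
    qed
  qed
qed

text \<open>The choice is harmless for finite trees, whose run exists by \<open>ex_run\<close> and
  is unique by \<open>run_unique\<close>.\<close>

definition run_state :: "'s dta \<Rightarrow> 's tree \<Rightarrow> nat" where
  "run_state M t = (SOME \<rho>. is_run M t \<rho>) []"

lemma run_state_eq:
  assumes "finite (dom t)" "is_run M t \<rho>" shows "\<rho> u = run_state M (subtree t u)"
proof -
  have r: "is_run M (subtree t u) (\<lambda>w. \<rho> (u @ w))" using assms(2) by (rule is_run_subtree)
  show ?thesis unfolding run_state_def
    using run_unique[OF finite_dom_subtree[OF assms(1)] r someI[of "is_run M (subtree t u)", OF r], of "[]"]
    by simp
qed

lemma run_state_rec:
  assumes "finite (dom t)"
  shows "run_state M t = (case t [] of None \<Rightarrow> init M
    | Some a \<Rightarrow> trans M (run_state M (subtree t [False])) a (run_state M (subtree t [True])))"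
proof -
  obtain \<rho> where \<rho>: "is_run M t \<rho>" using ex_run[OF assms] by blast
  then have "\<rho> [] = (case t [] of None \<Rightarrow> init M | Some a \<Rightarrow> trans M (\<rho> [False]) a (\<rho> [True]))"
    unfolding is_run_def by (metis append_Nil)
  then show ?thesis using run_state_eq[OF assms \<rho>] by (metis subtree_Nil)
qed

lemma lang_iff: "t \<in> lang M \<longleftrightarrow> is_tree (alphabet M) t \<and> run_state M t \<in> final M"
proof -
  have "(\<exists>\<rho>. is_run M t \<rho> \<and> \<rho> [] \<in> final M) \<longleftrightarrow> run_state M t \<in> final M" if "finite (dom t)"
    using ex_run[OF that] run_state_eq[OF that, of M _ "[]"] by (metis subtree_Nil)
  then show ?thesis unfolding lang_def is_tree_def by blast
qed

lemma run_state_in_states: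
  assumes M: "wf_dta M" and "finite (dom t)" "ran t \<subseteq> alphabet M"
  shows "run_state M t \<in> states M"
proof -
  have "run_state M t \<in> states M" if "\<forall>u\<in>dom t. length u < n" for n
    using that assms(2,3)
  proof (induction n arbitrary: t)
    case 0
    then have "t [] = None" by (auto simp: dom_def)
    then show ?case using M run_state_rec[OF 0(2), of M] unfolding wf_dta_def by simp
  next
    case (Suc n)
    have "run_state M (subtree t [b]) \<in> states M" for b
    proof (rule Suc.IH)
      show "ran (subtree t [b]) \<subseteq> alphabet M"
        using Suc.prems(3) by (auto simp: subtree_def ran_def)
      show "finite (dom (subtree t [b]))" using Suc.prems(2) by (rule finite_dom_subtree)
    qed (use Suc.prems in \<open>auto simp: subtree_def dom_def\<close>)
    then show ?case
      using M Suc.prems(3) ranI[of t "[]"] run_state_rec[OF Suc.prems(2), of M] unfolding wf_dta_def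
      by (cases "t []") auto
  qed
  then show ?thesis using depth_bound[OF assms(2)] by blast
qed

text \<open>\<open>None\<close> records a label outside the alphabet: the alphabet of an automaton for the order
  may fail to contain labels of convolutions of unrelated trees.\<close>

definition tree_value :: "'s dta \<Rightarrow> 's tree \<Rightarrow> nat option" where
  "tree_value M t = (if ran t \<subseteq> alphabet M then Some (run_state M t) else None)"

definition values_of :: "'s dta \<Rightarrow> nat option set" where
  "values_of M = insert None (Some ` states M)"

lemma finite_values_of: "wf_dta M \<Longrightarrow> finite (values_of M)"
  by (simp add: values_of_def wf_dta_def)

lemma tree_value_in: "wf_dta M \<Longrightarrow> finite (dom t) \<Longrightarrow> tree_value M t \<in> values_of M"
  by (simp add: tree_value_def values_of_def run_state_in_states)

text \<open>The alphabet condition moves into the value, so that among all finite trees the value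
  alone decides membership.\<close>

lemma lang_iff_tree_value:
  "t \<in> lang M \<longleftrightarrow> is_tree UNIV t \<and> tree_value M t \<in> Some ` final M"
  unfolding lang_iff is_tree_def tree_value_def by auto

section \<open>Cutting and gluing trees along a prefix-closed set\<close>

text \<open>The minimal positions outside \<open>D\<close>. For prefix-closed \<open>D\<close>, the
  cones below them partition the complement of \<open>D\<close>; if \<open>D\<close> is empty, the
  root is the only one.\<close>

definition frontier :: "bool list set \<Rightarrow> bool list set" where
  "frontier D = {u. u \<notin> D \<and> (\<forall>v w. u = v @ w \<longrightarrow> w \<noteq> [] \<longrightarrow> v \<in> D)}"

lemma finite_frontier: "finite D \<Longrightarrow> finite (frontier D)"
proof -
  assume D: "finite D"
  have "frontier D \<subseteq> insert [] ((\<lambda>(u, b). u @ [b]) ` (D \<times> UNIV))"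
  proof
    fix u assume u: "u \<in> frontier D"
    show "u \<in> insert [] ((\<lambda>(u, b). u @ [b]) ` (D \<times> UNIV))"
    proof (cases u rule: rev_cases)
      case (snoc v b)
      then have "v \<in> D" using u unfolding frontier_def by blast
      then show ?thesis using snoc by auto
    qed simp
  qed
  then show ?thesis using D by (auto intro: finite_subset)
qed

lemma frontier_unique:
  assumes "u \<in> frontier D" "u' \<in> frontier D" "u @ v = u' @ v'" shows "u = u'"
proof -
  obtain w where "u = u' @ w \<or> u @ w = u'"
    using assms(3) by (auto simp: append_eq_append_conv2)
  then show ?thesis using assms(1,2) unfolding frontier_def by (cases "w = []") auto
qed

locale prefix_closed =
  fixes D :: "bool list set"
  assumes finite: "finite D" and closed: "u @ v \<in> D \<Longrightarrow> u \<in> D"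
begin

lemma child: "u \<in> D \<Longrightarrow> u @ [b] \<in> D \<union> frontier D"
proof -
  assume u: "u \<in> D"
  have "v \<in> D" if "u @ [b] = v @ w" "w \<noteq> []" for v w
  proof -
    have "u = v @ butlast w" using that by (metis butlast_append butlast_snoc)
    then show ?thesis using u closed by blast
  qed
  then show ?thesis unfolding frontier_def by blast
qed

lemma root: "[] \<in> D \<union> frontier D"
  unfolding frontier_def by auto

lemma below_frontier: "w \<notin> D \<Longrightarrow> \<exists>u\<in>frontier D. \<exists>v. w = u @ v"
proof (induction w rule: rev_induct)
  case Nil
  then show ?case using root by auto
next
  case (snoc b w)
  show ?case
  proof (cases "w \<in> D")
    case True
    then have "w @ [b] \<in> frontier D" using child snoc.prems by blast
    then show ?thesis by blast
  next
    case False
    then show ?thesis using snoc.IH by (metis append.assoc)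
  qed
qed

lemma frontier_append: "u \<in> frontier D \<Longrightarrow> u @ v \<notin> D"
  using closed unfolding frontier_def by blast

lemma tree_eqI:
  assumes "\<And>u. u \<in> D \<Longrightarrow> t u = t' u" "\<And>u. u \<in> frontier D \<Longrightarrow> subtree t u = subtree t' u"
  shows "t = t'"
proof
  fix w show "t w = t' w"
  proof (cases "w \<in> D")
    case False
    then obtain u v where "u \<in> frontier D" "w = u @ v" using below_frontier by blast
    then show ?thesis using fun_cong[OF assms(2), of u v] by (simp add: subtree_def)
  qed (rule assms(1))
qed

text \<open>The states at the frontier and the labels on \<open>D\<close> determine the states on
  \<open>D\<close>, by induction from deep positions towards the root.\<close>

lemma run_state_cong:
  assumes fin: "finite (dom t)" "finite (dom t')" and D: "\<And>u. u \<in> D \<Longrightarrow> t u = t' u"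
    and fr: "\<And>u. u \<in> frontier D \<Longrightarrow> run_state M (subtree t u) = run_state M (subtree t' u)"
  shows "run_state M t = run_state M t'"
proof -
  obtain n where n: "\<forall>u\<in>D. length u < n" using depth_bound[OF finite] by blast
  have "run_state M (subtree t u) = run_state M (subtree t' u)" if "u \<in> D \<union> frontier D" for u
    using that
  proof (induction "n - length u" arbitrary: u rule: less_induct)
    case less
    show ?case
    proof (cases "u \<in> D")
      case True
      then have "length u < n" using n by blast
      then have "run_state M (subtree t (u @ [b])) = run_state M (subtree t' (u @ [b]))" for b
        using child[OF True] by (intro less) auto
      then show ?thesis
        using run_state_rec[OF finite_dom_subtree[OF fin(1)], of M u]
          run_state_rec[OF finite_dom_subtree[OF fin(2)], of M u] D[OF True]
        by (simp add: subtree_subtree split: option.split) (simp add: subtree_def)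
    qed (use fr less.prems in blast)
  qed
  from this[OF root] show ?thesis by simp
qed

lemma tree_value_cong:
  assumes fin: "finite (dom t)" "finite (dom t')" and D: "\<And>u. u \<in> D \<Longrightarrow> t u = t' u"
    and fr: "\<And>u. u \<in> frontier D \<Longrightarrow> tree_value M (subtree t u) = tree_value M (subtree t' u)"
  shows "tree_value M t = tree_value M t'"
proof -
  have ran: "ran t \<subseteq> alphabet M"
    if "ran t' \<subseteq> alphabet M" "\<And>u. u \<in> D \<Longrightarrow> t u = t' u"
      "\<And>u. u \<in> frontier D \<Longrightarrow> tree_value M (subtree t u) = tree_value M (subtree t' u)" for t t'
  proof
    fix a assume "a \<in> ran t"
    then obtain w where w: "t w = Some a" by (auto simp: ran_def)
    show "a \<in> alphabet M"
    proof (cases "w \<in> D")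
      case True
      then show ?thesis using that(1,2) w by (metis ranI subsetD)
    next
      case False
      then obtain u v where u: "u \<in> frontier D" "w = u @ v" using below_frontier by blast
      have "ran (subtree t' u) \<subseteq> alphabet M" using that(1) by (auto simp: subtree_def ran_def)
      then have "ran (subtree t u) \<subseteq> alphabet M"
        using that(3)[OF u(1)] unfolding tree_value_def by (auto split: if_splits)
      then show ?thesis using w u by (auto simp: subtree_def ran_def)
    qed
  qed
  show ?thesis
  proof (cases "ran t \<subseteq> alphabet M")
    case True
    then have True': "ran t' \<subseteq> alphabet M" using ran[of t t'] D fr by (metis ran)
    have "run_state M t = run_state M t'"
    proof (rule run_state_cong[OF fin D])
      fix u assume u: "u \<in> frontier D"
      have "ran (subtree t u) \<subseteq> alphabet M" "ran (subtree t' u) \<subseteq> alphabet M"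
        using True True' by (auto simp: subtree_def ran_def)
      then show "run_state M (subtree t u) = run_state M (subtree t' u)"
        using fr[OF u] by (simp add: tree_value_def)
    qed
    then show ?thesis using True True' by (simp add: tree_value_def)
  next
    case False
    then have "\<not> ran t' \<subseteq> alphabet M" using ran D fr by metis
    then show ?thesis using False by (simp add: tree_value_def)
  qed
qed

text \<open>The tree \<open>t\<close> on \<open>D\<close>, continued by \<open>f u\<close> below
  each frontier position \<open>u\<close>. The description is unique by
  \<open>frontier_unique\<close>.\<close>

definition glue :: "'s tree \<Rightarrow> (bool list \<Rightarrow> 's tree) \<Rightarrow> 's tree" where
  "glue t f w = (if w \<in> D then t w
     else let u = THE u. u \<in> frontier D \<and> (\<exists>v. w = u @ v) in f u (drop (length u) w))"

lemma glue_in: "w \<in> D \<Longrightarrow> glue t f w = t w"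
  by (simp add: glue_def)

lemma glue_append: "u \<in> frontier D \<Longrightarrow> glue t f (u @ v) = f u v"
proof -
  assume u: "u \<in> frontier D"
  then have "(THE u'. u' \<in> frontier D \<and> (\<exists>v'. u @ v = u' @ v')) = u"
    by (intro the_equality) (auto dest: frontier_unique)
  then show ?thesis using frontier_append[OF u] by (simp add: glue_def)
qed

lemma subtree_glue: "u \<in> frontier D \<Longrightarrow> subtree (glue t f) u = f u"
  by (simp add: subtree_def glue_append)

text \<open>The condition on \<open>None\<close> secures prefix-closedness across the frontier: if
  \<open>f u\<close> is nonempty then \<open>u\<close> lies in the domain of \<open>t\<close>, hence
  so do its ancestors, which belong to \<open>D\<close>.\<close>

lemma is_tree_glue:
  assumes t: "is_tree \<Sigma> t" and f: "\<And>u. u \<in> frontier D \<Longrightarrow> is_tree \<Sigma> (f u)"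
    and None: "\<And>u. u \<in> frontier D \<Longrightarrow> f u [] = None \<longleftrightarrow> t u = None"
  shows "is_tree \<Sigma> (glue t f)"
  unfolding is_tree_def
proof (intro conjI allI impI)
  have "dom (glue t f) \<subseteq> D \<union> (\<Union>u\<in>frontier D. (@) u ` dom (f u))"
  proof
    fix w assume w: "w \<in> dom (glue t f)"
    show "w \<in> D \<union> (\<Union>u\<in>frontier D. (@) u ` dom (f u))"
    proof (cases "w \<in> D")
      case False
      then obtain u v where u: "u \<in> frontier D" "w = u @ v" using below_frontier by blast
      then have "v \<in> dom (f u)" using w by (simp add: dom_def glue_append)
      then show ?thesis using u by blast
    qed simp
  qed
  moreover have "finite (dom (f u))" if "u \<in> frontier D" for u
    using f[OF that] unfolding is_tree_def by blast
  ultimately show "finite (dom (glue t f))"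
    using finite finite_frontier[OF finite] by (elim finite_subset) simp
next
  fix u v assume uv: "u @ v \<in> dom (glue t f)"
  have tcl: "\<And>u v. u @ v \<in> dom t \<Longrightarrow> u \<in> dom t" using t unfolding is_tree_def by blast
  show "u \<in> dom (glue t f)"
  proof (cases "u @ v \<in> D")
    case True
    then have "u \<in> D" by (rule closed)
    then show ?thesis using uv True tcl[of u v] by (simp add: glue_in dom_def)
  next
    case False
    then obtain x y where x: "x \<in> frontier D" "u @ v = x @ y" using below_frontier by blast
    have xy: "y \<in> dom (f x)" using uv x by (simp add: dom_def glue_append)
    have fcl: "\<And>u v. u @ v \<in> dom (f x) \<Longrightarrow> u \<in> dom (f x)"
      using f[OF x(1)] unfolding is_tree_def by blast
    obtain w where "u = x @ w \<and> w @ v = y \<or> u @ w = x" using x(2) by (auto simp: append_eq_append_conv2)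
    then consider "u = x @ w" "w @ v = y" | "u @ w = x" "w \<noteq> []" | "u = x" "w = []" by (cases "w = []") auto
    then show ?thesis
    proof cases
      case 1
      then show ?thesis using fcl[of w v] xy x(1) by (simp add: dom_def glue_append)
    next
      case 2
      then have "u \<in> D" using x(1) unfolding frontier_def by blast
      have "[] \<in> dom (f x)" using fcl[of "[]" y] xy by simp
      then have "x \<in> dom t" using None[OF x(1)] by (simp add: domIff)
      then have "u \<in> dom t" using tcl[of u w] 2 by simp
      then show ?thesis using \<open>u \<in> D\<close> by (simp add: glue_in dom_def)
    next
      case 3
      have "[] \<in> dom (f x)" using fcl[of "[]" y] xy by simp
      then show ?thesis using 3 glue_append[OF x(1), of t f "[]"] by (simp add: dom_def)
    qed
  qed
next
  show "ran (glue t f) \<subseteq> \<Sigma>"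
  proof
    fix a assume "a \<in> ran (glue t f)"
    then obtain w where w: "glue t f w = Some a" by (auto simp: ran_def)
    show "a \<in> \<Sigma>"
    proof (cases "w \<in> D")
      case True
      then have "t w = Some a" using w by (simp add: glue_in)
      then show ?thesis using t ranI unfolding is_tree_def by fast
    next
      case False
      then obtain u v where u: "u \<in> frontier D" "w = u @ v" using below_frontier by blast
      then have "f u v = Some a" using w by (simp add: glue_append)
      then show ?thesis using f[OF u(1)] ranI unfolding is_tree_def by fast
    qed
  qed
qed

end

lemma subtree_conv: "subtree (conv s t) u = conv (subtree s u) (subtree t u)"
  by (auto simp: subtree_def conv_def)

lemma dom_conv: "dom (conv s t) = dom s \<union> dom t"
  by (auto simp: conv_def dom_def split: if_splits)

lemma conv_inject: "conv s t = conv s' t' \<longleftrightarrow> s = s' \<and> t = t'"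
proof
  assume eq: "conv s t = conv s' t'"
  have "s u = s' u \<and> t u = t' u" for u
    using fun_cong[OF eq, of u] by (auto simp: conv_def split: if_splits)
  then show "s = s' \<and> t = t'" by auto
qed simp

lemma is_tree_conv: "is_tree \<Sigma> s \<Longrightarrow> is_tree \<Sigma> t \<Longrightarrow> is_tree UNIV (conv s t)"
  unfolding is_tree_def dom_conv by blast

lemma lang_tree: "x \<in> lang M \<Longrightarrow> is_tree (alphabet M) x"
  by (simp add: lang_iff)

lemma tree_finite: "is_tree \<Sigma> x \<Longrightarrow> finite (dom x)"
  by (simp add: is_tree_def)

section \<open>Intervals of tree-automatic orders\<close>

locale tree_automatic_order =
  fixes M :: "nat dta" and Mle :: "(nat option \<times> nat option) dta"
  assumes wf_M: "wf_dta M" and wf_Mle: "wf_dta Mle"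
    and lin_lang: "lin_on (lang M) (\<lambda>s t. conv s t \<in> lang Mle)"
begin

abbreviation tle :: "nat tree \<Rightarrow> nat tree \<Rightarrow> bool" where
  "tle s t \<equiv> conv s t \<in> lang Mle"

abbreviation colour :: "nat tree \<Rightarrow> nat tree \<Rightarrow> nat option" where
  "colour s t \<equiv> tree_value Mle (conv s t)"

text \<open>The type of a subtree below the domains of the end points of an interval: it determines
  how the subtree acts on membership in the interval. The last component says whether the
  subtree is empty, which matters for prefix-closedness when subtrees are exchanged.\<close>

definition tree_type where
  "tree_type s = (tree_value M s, colour Map.empty s, colour s Map.empty, colour s s, s [] = None)"

definition tree_types where
  "tree_types = values_of M \<times> values_of Mle \<times> values_of Mle \<times> values_of Mle \<times> (UNIV :: bool set)"

definition trees_of_type where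
  "trees_of_type q = {s. is_tree (alphabet M) s \<and> tree_type s = q}"

lemma colour_in:
  "is_tree \<Sigma> s \<Longrightarrow> is_tree \<Sigma>' t \<Longrightarrow> colour s t \<in> values_of Mle"
  by (intro tree_value_in wf_Mle) (simp add: dom_conv is_tree_def)

lemma finite_tree_types: "finite tree_types"
  by (simp add: tree_types_def finite_values_of wf_M wf_Mle)

lemma tree_type_in: "is_tree \<Sigma> s \<Longrightarrow> tree_type s \<in> tree_types"
  unfolding tree_type_def tree_types_def
  by (auto intro!: tree_value_in wf_M wf_Mle simp: dom_conv is_tree_def)

lemma tle_iff: "is_tree \<Sigma> s \<Longrightarrow> is_tree \<Sigma> t \<Longrightarrow> tle s t \<longleftrightarrow> colour s t \<in> Some ` final Mle"
  by (simp add: lang_iff_tree_value is_tree_conv)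

text \<open>Each factor of the product decomposition embeds into the interval and inherits the bound
  \<omega>^(k+1). By the gap its rank is below \<omega>^k, and this bound passes back to products
  and to finite unions.\<close>

lemma rank_less_interval:
  fixes k :: nat
  assumes gap: "\<And>q W. q \<in> tree_types \<Longrightarrow> W \<subseteq> values_of Mle \<Longrightarrow>
      rank_less (\<lambda>s t. colour s t \<in> W) {#Suc k#} (trees_of_type q) \<Longrightarrow>
      rank_less (\<lambda>s t. colour s t \<in> W) {#k#} (trees_of_type q)"
    and a: "a \<in> lang M" and b: "b \<in> lang M"
    and rank: "rank_less tle {#Suc k#} {x \<in> lang M. tle a x \<and> tle x b}"
  shows "rank_less tle {#k#} {x \<in> lang M. tle a x \<and> tle x b}"
proof -
  define I where "I = {x \<in> lang M. tle a x \<and> tle x b}"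
  define D where "D = dom a \<union> dom b"
  interpret prefix_closed D
    using lang_tree[OF a] lang_tree[OF b] unfolding D_def is_tree_def by unfold_locales blast+
  define Fr where "Fr = frontier D"
  have finFr: "finite Fr" unfolding Fr_def by (rule finite_frontier[OF finite])
  \<comment> \<open>Trees with the same profile agree on \<open>D\<close> and have subtrees of the
    same types at the frontier; they form one product.\<close>
  define profile where
    "profile x = (\<lambda>u\<in>D. x u, \<lambda>u\<in>Fr. tree_type (subtree x u))" for x :: "nat tree"
  have I_lang: "x \<in> lang M" and I_tree: "is_tree (alphabet M) x" if "x \<in> I" for x
    using that lang_tree unfolding I_def by auto
  have fin_profile: "finite (profile ` I)"
  proof (rule finite_subset)
    let ?L = "insert None (Some ` alphabet M)"
    show "profile ` I \<subseteq> (D \<rightarrow>\<^sub>E ?L) \<times> (Fr \<rightarrow>\<^sub>E tree_types)"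
    proof (rule image_subsetI)
      fix x assume x: "x \<in> I"
      have "x u \<in> ?L" for u
        using I_tree[OF x] unfolding is_tree_def by (cases "x u") (auto intro: ranI)
      moreover have "tree_type (subtree x u) \<in> tree_types" for u
        by (rule tree_type_in[OF is_tree_subtree[OF I_tree[OF x]]])
      ultimately show "profile x \<in> (D \<rightarrow>\<^sub>E ?L) \<times> (Fr \<rightarrow>\<^sub>E tree_types)"
        unfolding profile_def by simp
    qed
    have "finite ?L" using wf_M unfolding wf_dta_def by simp
    then show "finite ((D \<rightarrow>\<^sub>E ?L) \<times> (Fr \<rightarrow>\<^sub>E tree_types))"
      using finite finFr finite_tree_types by (simp add: finite_PiE)
  qed
  have piece: "rank_less tle {#k#} {x\<in>I. profile x = profile x\<^sub>0}" if x0: "x\<^sub>0 \<in> I" for x\<^sub>0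
  proof -
    note t0 = I_tree[OF x0]
    define T where "T u = trees_of_type (tree_type (subtree x\<^sub>0 u))" for u
    define G where "G = glue x\<^sub>0"
    define c where "c f g = (\<lambda>u\<in>Fr. colour (f u) (g u))" for f g :: "bool list \<Rightarrow> nat tree"
    define le where "le f g \<longleftrightarrow> tle (G f) (G g)" for f g
    \<comment> \<open>\<open>P\<close> accepts the colour vectors realised by some comparable pair;
      \<open>le_P\<close> shows that any pair with such a vector is then comparable.\<close>
    define P where "P h \<longleftrightarrow> (\<exists>f\<in>Pi\<^sub>E Fr T. \<exists>g\<in>Pi\<^sub>E Fr T. c f g = h \<and> le f g)" for h
    define d where "d u = colour (subtree x\<^sub>0 u) (subtree x\<^sub>0 u)" for u
    define f\<^sub>0 where "f\<^sub>0 = (\<lambda>u\<in>Fr. subtree x\<^sub>0 u)"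
    have T: "is_tree (alphabet M) s" "tree_type s = tree_type (subtree x\<^sub>0 u)" if "s \<in> T u" for s u
      using that unfolding T_def trees_of_type_def by auto
    have G_sub: "subtree (G f) u = f u" if "u \<in> Fr" for f u
      using that subtree_glue unfolding G_def Fr_def by blast
    have G_D: "G f u = x\<^sub>0 u" if "u \<in> D" for f u
      using that glue_in unfolding G_def by blast
    have G_tree: "is_tree (alphabet M) (G f)" if f: "f \<in> Pi\<^sub>E Fr T" for f
      unfolding G_def
    proof (rule is_tree_glue[OF t0])
      fix u assume "u \<in> frontier D"
      then have fu: "f u \<in> T u" using f unfolding Fr_def by (rule PiE_mem[rotated])
      show "is_tree (alphabet M) (f u)" using T(1)[OF fu] .
      show "f u [] = None \<longleftrightarrow> x\<^sub>0 u = None"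
        using T(2)[OF fu] by (simp add: tree_type_def subtree_def)
    qed
    \<comment> \<open>The end points have no nodes from the frontier on, so there the convolutions
      with \<open>a\<close> and \<open>b\<close> have the values recorded in the second and third
      component of \<open>tree_type\<close>.\<close>
    have empty_sub: "subtree a u = Map.empty" "subtree b u = Map.empty" if "u \<in> Fr" for u
    proof -
      have "u @ v \<notin> D" for v using frontier_append that unfolding Fr_def by blast
      then show "subtree a u = Map.empty" "subtree b u = Map.empty"
        unfolding D_def subtree_def by (auto simp: fun_eq_iff dom_def)
    qed
    have G_I: "G f \<in> I" if f: "f \<in> Pi\<^sub>E Fr T" for f
    proof -
      note Gt = G_tree[OF f]
      have fT: "f u \<in> T u" if "u \<in> frontier D" for u using f that unfolding Fr_def by (rule PiE_mem)
      have "tree_value M (G f) = tree_value M x\<^sub>0"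
      proof (rule tree_value_cong[OF tree_finite[OF Gt] tree_finite[OF t0] G_D])
        fix u assume u: "u \<in> frontier D"
        show "tree_value M (subtree (G f) u) = tree_value M (subtree x\<^sub>0 u)"
          using T(2)[OF fT[OF u]] G_sub[of u f] u by (simp add: tree_type_def Fr_def)
      qed
      moreover have "is_tree UNIV (G f)" using Gt unfolding is_tree_def by blast
      ultimately have "G f \<in> lang M" using I_lang[OF x0] by (simp add: lang_iff_tree_value)
      moreover have "colour a (G f) = colour a x\<^sub>0"
      proof (rule tree_value_cong)
        fix u assume u: "u \<in> frontier D"
        show "tree_value Mle (subtree (conv a (G f)) u) = tree_value Mle (subtree (conv a x\<^sub>0) u)"
          using T(2)[OF fT[OF u]] G_sub[of u f] empty_sub[of u] u
          by (simp add: tree_type_def Fr_def subtree_conv)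
      next
        fix u assume "u \<in> D"
        then show "conv a (G f) u = conv a x\<^sub>0 u" using G_D by (simp add: conv_def)
      qed (use Gt t0 lang_tree[OF a] tree_finite in \<open>auto simp: dom_conv\<close>)
      moreover have "colour (G f) b = colour x\<^sub>0 b"
      proof (rule tree_value_cong)
        fix u assume u: "u \<in> frontier D"
        show "tree_value Mle (subtree (conv (G f) b) u) = tree_value Mle (subtree (conv x\<^sub>0 b) u)"
          using T(2)[OF fT[OF u]] G_sub[of u f] empty_sub[of u] u
          by (simp add: tree_type_def Fr_def subtree_conv)
      next
        fix u assume "u \<in> D"
        then show "conv (G f) b u = conv x\<^sub>0 b u" using G_D by (simp add: conv_def)
      qed (use Gt t0 lang_tree[OF b] tree_finite in \<open>auto simp: dom_conv\<close>)
      ultimately show ?thesis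
        using x0 tle_iff[OF lang_tree[OF a] Gt] tle_iff[OF Gt lang_tree[OF b]]
          tle_iff[OF lang_tree[OF a] t0] tle_iff[OF t0 lang_tree[OF b]]
        unfolding I_def by simp
    qed
    have G_inj: "inj_on G (Pi\<^sub>E Fr T)"
    proof (rule inj_onI)
      fix f g assume fg: "f \<in> Pi\<^sub>E Fr T" "g \<in> Pi\<^sub>E Fr T" "G f = G g"
      then show "f = g" using G_sub by (intro PiE_ext[OF fg(1,2)]) metis
    qed
    have lin: "lin_on (Pi\<^sub>E Fr T) le"
      by (rule lin_on_pullback[OF lin_lang _ G_inj]) (use G_I I_lang in \<open>auto simp: le_def\<close>)
    have le_P: "le f g \<longleftrightarrow> P (c f g)" if fg: "f \<in> Pi\<^sub>E Fr T" "g \<in> Pi\<^sub>E Fr T" for f g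
    proof
      assume "P (c f g)"
      then obtain f' g' where fg': "f' \<in> Pi\<^sub>E Fr T" "g' \<in> Pi\<^sub>E Fr T" "c f' g' = c f g" "le f' g'"
        unfolding P_def by blast
      have "colour (G f) (G g) = colour (G f') (G g')"
      proof (rule tree_value_cong)
        fix u assume u: "u \<in> frontier D"
        then have "colour (f' u) (g' u) = colour (f u) (g u)"
          using fun_cong[OF fg'(3), of u] by (simp add: c_def Fr_def)
        then show "tree_value Mle (subtree (conv (G f) (G g)) u) =
            tree_value Mle (subtree (conv (G f') (G g')) u)"
          using G_sub[of u] u by (simp add: subtree_conv Fr_def)
      next
        fix u assume "u \<in> D"
        then show "conv (G f) (G g) u = conv (G f') (G g') u" using G_D by (simp add: conv_def)
      qed (use fg fg' tree_finite[OF G_tree] in \<open>auto simp: dom_conv\<close>)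
      then show "le f g" using fg'(4) tle_iff[OF G_tree G_tree] fg fg' unfolding le_def by simp
    qed (use fg in \<open>auto simp: P_def\<close>)
    have diag: "colour s s = d u" if "s \<in> T u" for s u
      using T(2)[OF that] by (simp add: tree_type_def d_def)
    have f0: "f\<^sub>0 \<in> Pi\<^sub>E Fr T"
      unfolding f\<^sub>0_def T_def trees_of_type_def using is_tree_subtree[OF t0] by simp
    have component: "rank_less (\<lambda>s t. P ((restrict d Fr)(u := colour s t))) {#k#} (T u)"
      if u: "u \<in> Fr" for u
    proof -
      \<comment> \<open>The colours accepted at \<open>u\<close> while all other coordinates have
        their diagonal colours. As a subset of \<open>values_of Mle\<close>, it is one of finitely
        many sets, independently of the interval.\<close>
      define W where "W = {w \<in> values_of Mle. P ((restrict d Fr)(u := w))}"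
      have upd: "f\<^sub>0(u := s) \<in> Pi\<^sub>E Fr T" if "s \<in> T u" for s
        using PiE_fun_upd[of s T u f\<^sub>0 Fr, OF that f0] u by (simp add: insert_absorb)
      have c_upd: "c (f\<^sub>0(u := s)) (f\<^sub>0(u := t)) = (restrict d Fr)(u := colour s t)" for s t
        using u by (auto simp: c_def f\<^sub>0_def d_def fun_eq_iff)
      have "rank_less (\<lambda>s t. colour s t \<in> W) {#Suc k#} (T u)"
      \<comment> \<open>Varying only the subtree of \<open>x\<^sub>0\<close> at \<open>u\<close>
        embeds the factor into the interval.\<close>
      proof (rule rank_less_embed[OF rank, of "\<lambda>s. G (f\<^sub>0(u := s))"])
        show "(\<lambda>s. G (f\<^sub>0(u := s))) ` T u \<subseteq> {x \<in> lang M. tle a x \<and> tle x b}"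
          using G_I upd unfolding I_def by blast
        show "inj_on (\<lambda>s. G (f\<^sub>0(u := s))) (T u)"
          by (rule inj_onI) (metis G_sub[OF u] fun_upd_same)
        fix s t assume st: "s \<in> T u" "t \<in> T u" "colour s t \<in> W"
        then have "P (c (f\<^sub>0(u := s)) (f\<^sub>0(u := t)))" unfolding c_upd W_def by blast
        then show "tle (G (f\<^sub>0(u := s))) (G (f\<^sub>0(u := t)))"
          using le_P[OF upd upd] st unfolding le_def by blast
      qed
      then have "rank_less (\<lambda>s t. colour s t \<in> W) {#k#} (T u)"
        unfolding T_def
        by (intro gap tree_type_in[OF is_tree_subtree[OF t0]]) (auto simp: W_def)
      then show ?thesis
      proof (rule rank_less_embed[where f = "\<lambda>s. s"])
        fix s t assume "s \<in> T u" "t \<in> T u" "P ((restrict d Fr)(u := colour s t))"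
        then show "colour s t \<in> W" using colour_in[OF T(1) T(1)] unfolding W_def by blast
      qed auto
    qed
    have "rank_less le {#k#} (Pi\<^sub>E Fr T)"
    proof (rule rank_less_PiE[OF finFr lin, of P colour "values_of Mle" d])
      show "le f g = P (\<lambda>u\<in>Fr. colour (f u) (g u))" if "f \<in> Pi\<^sub>E Fr T" "g \<in> Pi\<^sub>E Fr T" for f g
        using le_P[OF that] unfolding c_def .
    qed (use finite_values_of[OF wf_Mle] colour_in[OF T(1) T(1)] diag component in auto)
    then show ?thesis
    proof (rule rank_less_embed[where f = "\<lambda>x. \<lambda>u\<in>Fr. subtree x u"])
      let ?\<phi> = "\<lambda>x. \<lambda>u\<in>Fr. subtree x u" and ?X = "{x \<in> I. profile x = profile x\<^sub>0}"
      have G_\<phi>: "G (?\<phi> x) = x" if "x \<in> ?X" for x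
      proof (rule tree_eqI)
        fix u assume u: "u \<in> D"
        have "fst (profile x) u = fst (profile x\<^sub>0) u" using that by simp
        then show "G (?\<phi> x) u = x u" using u G_D by (simp add: profile_def)
      next
        fix u assume "u \<in> frontier D"
        then show "subtree (G (?\<phi> x)) u = subtree x u" using G_sub by (simp add: Fr_def)
      qed
      show "?\<phi> ` ?X \<subseteq> Pi\<^sub>E Fr T"
      proof (rule image_subsetI)
        fix x assume x: "x \<in> ?X"
        have "subtree x u \<in> T u" if u: "u \<in> Fr" for u
        proof -
          have "snd (profile x) u = snd (profile x\<^sub>0) u" using x by simp
          then have "tree_type (subtree x u) = tree_type (subtree x\<^sub>0 u)"
            using u by (simp add: profile_def)
          then show ?thesis using x is_tree_subtree[OF I_tree] unfolding T_def trees_of_type_def by blast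
        qed
        then show "?\<phi> x \<in> Pi\<^sub>E Fr T" by simp
      qed
      show "inj_on ?\<phi> ?X" by (rule inj_on_inverseI[of _ G]) (rule G_\<phi>)
      show "le (?\<phi> x) (?\<phi> y)" if "x \<in> ?X" "y \<in> ?X" "tle x y" for x y
        unfolding le_def using G_\<phi>[OF that(1)] G_\<phi>[OF that(2)] that(3) by simp
    qed
  qed
  have "rank_less tle {#k#} (\<Union>((\<lambda>\<pi>. {x\<in>I. profile x = \<pi>}) ` profile ` I))"
  proof (rule rank_less_Union)
    show "{#} < {#k#}" by simp
  qed (use fin_profile piece in auto)
  then have "rank_less tle {#k#} I" by (rule rank_less_subset) blast
  then show ?thesis unfolding I_def .
qed

text \<open>For each of the finitely many pairs \<open>(q, W)\<close>, at most one \<open>k\<close>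
  is bad, namely the one with rank from \<omega>^k on but below \<omega>^(k+1). So only finitely
  many \<open>k\<close> are bad in total.\<close>

lemma ex_gap:
  "\<exists>k :: nat. \<forall>q\<in>tree_types. \<forall>W. W \<subseteq> values_of Mle \<longrightarrow>
    rank_less (\<lambda>s t. colour s t \<in> W) {#Suc k#} (trees_of_type q) \<longrightarrow>
    rank_less (\<lambda>s t. colour s t \<in> W) {#k#} (trees_of_type q)"
proof -
  define bad where "bad = (\<lambda>(q, W). {k :: nat. rank_less (\<lambda>s t. colour s t \<in> W) {#Suc k#} (trees_of_type q) \<and>
    \<not> rank_less (\<lambda>s t. colour s t \<in> W) {#k#} (trees_of_type q)})"
  have "finite (bad p)" for p
  proof (cases "bad p = {}")
    case False
    then obtain k where k: "k \<in> bad p" by blast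
    have "\<not> k' < k''" if "k' \<in> bad p" "k'' \<in> bad p" for k' k''
    proof
      assume "k' < k''"
      then have "{#Suc k'#} \<le> {#k''#}" by (metis Suc_leI le_neq_implies_less less_imp_le mset_lt_single_iff order_refl)
      then show False using that rank_less_mono unfolding bad_def by (cases p) blast
    qed
    then have "bad p \<subseteq> {k}" using k by (metis nat_neq_iff singletonI subsetI)
    then show ?thesis by (rule finite_subset) simp
  qed simp
  then have "finite (\<Union>(bad ` (tree_types \<times> Pow (values_of Mle))))"
    using finite_tree_types finite_values_of[OF wf_Mle] by simp
  then obtain k where "k \<notin> \<Union>(bad ` (tree_types \<times> Pow (values_of Mle)))"
    using ex_new_if_finite[OF infinite_UNIV_nat] by blast
  then show ?thesis by (intro exI[of _ k]) (auto simp: bad_def)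
qed

end

section \<open>Stabilisation of the condensations at \<omega>^k\<close>

theorem theorem4p4:
  fixes A :: "'a set" and r :: "'a rel"
  assumes "linear_order_on A r"
    and "tree_automatic A r"
  shows "FC_less_omega_omega A r"
proof -
  let ?r = "\<lambda>x y. (x, y) \<in> r"
  obtain M :: "nat dta" and Mle and \<mu> :: "'a \<Rightarrow> nat tree" where wf: "wf_dta M" "wf_dta Mle" and bij: "bij_betw \<mu> A (lang M)"
    and Mle: "lang Mle = {conv (\<mu> a) (\<mu> b) | a b. a \<in> A \<and> b \<in> A \<and> (a, b) \<in> r}"
    using assms(2) unfolding tree_automatic_def by (elim exE conjE)
  have inj: "inj_on \<mu> A" and im: "\<mu> ` A = lang M" using bij unfolding bij_betw_def by auto
  have linA: "lin_on A ?r"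
    using assms(1) unfolding lin_on_def linear_order_on_def partial_order_on_def preorder_on_def
      refl_on_def antisym_def Relation.trans_def total_on_def by (intro conjI; metis)
  have tle: "conv (\<mu> a) (\<mu> b) \<in> lang Mle \<longleftrightarrow> (a, b) \<in> r" if "a \<in> A" "b \<in> A" for a b
    using that inj unfolding Mle by (auto simp: conv_inject dest: inj_onD)
  define \<nu> where "\<nu> = inv_into A \<mu>"
  have \<nu>: "\<nu> t \<in> A" "\<mu> (\<nu> t) = t" if "t \<in> lang M" for t
    using that inv_into_into[of t \<mu> A] f_inv_into_f[of t \<mu> A] im unfolding \<nu>_def by auto
  have inj_\<nu>: "inj_on \<nu> (lang M)" by (rule inj_on_inverseI[of _ \<mu>]) (rule \<nu>)
  have tle_\<nu>: "conv s t \<in> lang Mle \<longleftrightarrow> (\<nu> s, \<nu> t) \<in> r" if "s \<in> lang M" "t \<in> lang M" for s t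
    using tle[OF \<nu>(1) \<nu>(1), OF that] \<nu>(2) that by simp
  interpret tree_automatic_order M Mle
  proof
    show "lin_on (lang M) (\<lambda>s t. conv s t \<in> lang Mle)"
      by (rule lin_on_pullback[OF linA _ inj_\<nu> tle_\<nu>]) (use \<nu> in auto)
  qed (rule wf)+
  obtain k :: nat where gap: "\<And>q W. q \<in> tree_types \<Longrightarrow> W \<subseteq> values_of Mle \<Longrightarrow>
      rank_less (\<lambda>s t. colour s t \<in> W) {#Suc k#} (trees_of_type q) \<Longrightarrow>
      rank_less (\<lambda>s t. colour s t \<in> W) {#k#} (trees_of_type q)"
    using ex_gap by blast
  have step: "(x, y) \<in> fc_cond A r {#k#}"
    if xy: "(x, y) \<in> fc_step A r (fc_cond A r {#k#})" "(x, y) \<in> r" for x y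
  proof -
    have A: "x \<in> A" "y \<in> A" using xy(1) unfolding fc_step_def by auto
    let ?J = "{t \<in> lang M. tle (\<mu> x) t \<and> tle t (\<mu> y)}"
    \<comment> \<open>\<open>{#k, k#}\<close> merely witnesses that the successor of
      \<open>{#k#}\<close> exists and lies below \<open>{#Suc k#}\<close>.\<close>
    have "{#k#} < {#k, k#}" by simp
    note succ = is_succ_of_Least[OF this]
    have "(x, y) \<in> fc_cond A r (LEAST \<gamma>. {#k#} < \<gamma>)" using xy(1) fc_cond_succ[OF succ(1)] by blast
    then have "rank_le ?r (LEAST \<gamma>. {#k#} < \<gamma>) (between A r x y)"
      by (rule rank_le_between[OF linA _ xy(2)])
    moreover have "(LEAST \<gamma>. {#k#} < \<gamma>) < {#Suc k#}" by (rule le_less_trans[OF succ(2)]) simp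
    ultimately have "rank_less ?r {#Suc k#} (between A r x y)" unfolding rank_less_def by blast
    then have "rank_less tle {#Suc k#} ?J"
    proof (rule rank_less_embed[where f = \<nu>])
      show "\<nu> ` ?J \<subseteq> between A r x y"
        using \<nu> tle A unfolding between_def by (auto, metis+)
    qed (use inj_\<nu> tle_\<nu> in \<open>auto intro: inj_on_subset\<close>)
    \<comment> \<open>The gap lowers the bound from \<omega>^(k+1) to \<omega>^k. As this bound is
      strict, the pair belongs to stage \<open>{#k#}\<close> itself.\<close>
    then have "rank_less tle {#k#} ?J"
      by (rule rank_less_interval[OF gap, rotated -1]) (use A im in auto)
    then have "rank_less ?r {#k#} (between A r x y)"
      by (rule rank_less_embed[where f = \<mu>])
        (use inj im tle A in \<open>auto simp: between_def intro: inj_on_subset\<close>)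
    then show ?thesis by (rule fc_cond_if_rank_less[OF linA _ A xy(2)])
  qed
  have "fc_step A r (fc_cond A r {#k#}) \<subseteq> fc_cond A r {#k#}"
  proof (rule subrelI)
    fix x y assume xy: "(x, y) \<in> fc_step A r (fc_cond A r {#k#})"
    then have A: "x \<in> A" "y \<in> A" unfolding fc_step_def by auto
    show "(x, y) \<in> fc_cond A r {#k#}"
    proof (cases "(x, y) \<in> r")
      case False
      then have "(y, x) \<in> r" using lin_on_linear[OF linA] A by blast
      then have "(y, x) \<in> fc_cond A r {#k#}" using step fc_step_sym[OF xy] by blast
      then show ?thesis using equiv_fc_cond[OF linA] by (meson equivE symE)
    qed (rule step[OF xy])
  qed
  then have "fc_stable_from A r {#k#}" by (rule fc_stable_fromI[OF linA])
  then show ?thesis unfolding FC_less_omega_omega_def by blast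
qed

end
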